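(* Let $\Xi\subset\mathbb{R}^n$ be a nonempty, connected, compact set, let $\alpha\ge 1$ and $0<\epsilon<0.5$, and let $\mu\in\mathbb{R}^n$ and a symmetric $\Sigma\in\mathbb{R}^{n\times n}$ be such that for all $m\in\Xi$ $$\Big(\tfrac{\alpha+2}{\alpha}\Big)(\Sigma-\mu\mu^{\top})\succ\tfrac{1}{\alpha^2}(\mu-m)(\mu-m)^{\top}.$$ Let $a:\mathbb{R}^l\to\mathbb{R}^n$ and $b:\mathbb{R}^l\to\mathbb{R}$ be affine, and let $x\in\mathbb{R}^l$ satisfy $a(x)^{\top}m\le b(x)$ for all $m\in\Xi$. Then the distributionally robust chance constraint $$\inf_{\mathbb{P}_\xi\in\mathcal{D}^3_\xi}\mathbb{P}_\xi\big(a(x)^{\top}\xi\le b(x)\big)\ge 1-\epsilon$$ holds if and only if, for all $\tau\ge\big(\tfrac{1}{1-\epsilon}\big)^{1/\alpha}$ and all $m\in\Xi$, $$\sqrt{\frac{1-\epsilon-\tau^{-\alpha}}{\epsilon}}\,\big\|\Lambda_m a(x)\big\|\le \tau\big(b(x)-\mu^{\top}a(x)\big)+\Big(\tau-\frac{\alpha+1}{\alpha}\Big)(\mu-m)^{\top}a(x),$$ where $$\Lambda_m:=\Big(\big(\tfrac{\alpha+2}{\alpha}\big)(\Sigma-\mu\mu^{\top})-\tfrac{1}{\alpha^2}(\mu-m)(\mu-m)^{\top}\Big)^{1/2}.$$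
   Context: A probability distribution $\mathbb{P}$ on $\mathbb{R}^n$ (with Borel $\sigma$-algebra $\mathcal{B}^n$) is called $\alpha$-unimodal with mode $0$ ($\alpha>0$) if $t^{\alpha}\,\mathbb{P}(B/t)$ is non-decreasing in $t>0$ for every Borel set $B\in\mathcal{B}^n$. The distribution of a random vector $\xi$ is $\alpha$-unimodal with mode $m\in\mathbb{R}^n$ if the distribution of $\xi-m$ is $\alpha$-unimodal with mode $0$. The ambiguity set $\mathcal{D}^3_\xi$ is the set of all probability distributions $\mathbb{P}_\xi$ on $\mathbb{R}^n$ such that $\mathbb{E}_{\mathbb{P}_\xi}[\xi]=\mu$, $\mathbb{E}_{\mathbb{P}_\xi}[\xi\xi^{\top}]=\Sigma$ (second moment matrix, not covariance), and $\mathbb{P}_\xi$ is $\alpha$-unimodal with mode $m$ for some $m\in\Xi$. $\|\cdot\|$ is the Euclidean norm, $A\succ B$ means $A-B$ is positive definite, and $(\cdot)^{1/2}$ is the symmetric positive definite square root. *)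

theory Defs
  imports "HOL-Probability.Probability"
begin

definition outer :: "real^'n \<Rightarrow> real^'n \<Rightarrow> real^'n^'n"
  where "outer u v = (\<chi> i j. u $ i * v $ j)"

definition pos_def :: "real^'n^'n \<Rightarrow> bool"
  where "pos_def A \<longleftrightarrow> transpose A = A \<and> (\<forall>v. v \<noteq> 0 \<longrightarrow> 0 < v \<bullet> (A *v v))"

definition mat_succ :: "real^'n^'n \<Rightarrow> real^'n^'n \<Rightarrow> bool"  (infix "\<succ>" 50)
  where "A \<succ> B \<longleftrightarrow> pos_def (A - B)"

definition mat_sqrt :: "real^'n^'n \<Rightarrow> real^'n^'n"
  where "mat_sqrt A = (THE R. pos_def R \<and> R ** R = A)"

definition affine_map :: "('a::real_vector \<Rightarrow> 'b::real_vector) \<Rightarrow> bool"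
  where "affine_map f \<longleftrightarrow> (\<exists>g c. linear g \<and> (\<forall>x. f x = g x + c))"

definition alpha_unimodal0 :: "real \<Rightarrow> (real^'n) measure \<Rightarrow> bool"
  where "alpha_unimodal0 \<alpha> P \<longleftrightarrow>
    (\<forall>B\<in>sets borel. mono_on {0<..} (\<lambda>t. t powr \<alpha> * measure P ((\<lambda>z. z /\<^sub>R t) ` B)))"

definition alpha_unimodal :: "real \<Rightarrow> real^'n \<Rightarrow> (real^'n) measure \<Rightarrow> bool"
  where "alpha_unimodal \<alpha> m P \<longleftrightarrow> alpha_unimodal0 \<alpha> (distr P borel (\<lambda>\<xi>. \<xi> - m))"

text \<open>The two moment conditions include existence of the moments: the Bochner integral of a
  non-integrable function is 0 by convention.\<close>

definition ambiguity_set ::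
    "(real^'n) set \<Rightarrow> real \<Rightarrow> real^'n \<Rightarrow> real^'n^'n \<Rightarrow> (real^'n) measure set"
  where "ambiguity_set \<Xi> \<alpha> \<mu> \<Sigma> = {P. prob_space P \<and> sets P = sets borel
    \<and> integrable P (\<lambda>\<xi>. \<xi>) \<and> (\<integral>\<xi>. \<xi> \<partial>P) = \<mu>
    \<and> integrable P (\<lambda>\<xi>. outer \<xi> \<xi>) \<and> (\<integral>\<xi>. outer \<xi> \<xi> \<partial>P) = \<Sigma>
    \<and> (\<exists>m\<in>\<Xi>. alpha_unimodal \<alpha> m P)}"

definition Lambda :: "real \<Rightarrow> real^'n \<Rightarrow> real^'n^'n \<Rightarrow> real^'n \<Rightarrow> real^'n^'n"
  where "Lambda \<alpha> \<mu> \<Sigma> m = mat_sqrt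
    (((\<alpha> + 2) / \<alpha>) *\<^sub>R (\<Sigma> - outer \<mu> \<mu>) - (1 / \<alpha>\<^sup>2) *\<^sub>R outer (\<mu> - m) (\<mu> - m))"

end

theory Submission
  imports Defs
begin

text \<open>
An \<open>\<alpha>\<close>-unimodal law with mode \<open>m\<close> is the law of \<open>m + U\<^bsup>1/\<alpha>\<^esup> Z\<close> with \<open>U\<close> uniform on the unit
interval and \<open>Z\<close> independent of \<open>U\<close>. Since \<open>U\<^bsup>1/\<alpha>\<^esup>\<close> has first two moments \<open>\<alpha>/(\<alpha>+1)\<close> and
\<open>\<alpha>/(\<alpha>+2)\<close>, fixing \<open>\<mu>\<close> and \<open>\<Sigma>\<close> amounts to giving \<open>Z\<close> mean \<open>((\<alpha>+1)/\<alpha>)(\<mu>-m)\<close> and covariance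
\<open>\<Lambda>\<^sub>m\<^sup>2\<close>. Write \<open>Y = a \<bullet> Z\<close>, with mean \<open>\<rho>\<close> and standard deviation \<open>\<sigma> = \<parallel>\<Lambda>\<^sub>m a\<parallel>\<close>, and
\<open>d = b - a \<bullet> m \<ge> 0\<close>. Given \<open>Y = y > d\<close>, the constraint is violated with probability
\<open>\<phi>(y) = 1 - (d/y)\<^bsup>\<alpha>\<^esup>\<close>, and otherwise with probability \<open>0\<close>. The theorem therefore says that the
largest value of \<open>E \<phi>(Y)\<close> over all \<open>Y\<close> with these two moments is at most \<open>\<epsilon>\<close> if and only if
\<open>\<sigma> sqrt ((1 - \<epsilon> - \<tau>\<^bsup>-\<alpha>\<^esup>) / \<epsilon>) + \<rho> \<le> \<tau> d\<close> for all admissible \<open>\<tau>\<close>; this is the stated inequality.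

Sufficiency. As \<open>\<phi>\<close> is concave on \<open>{d<..}\<close>, Jensen's inequality on the event \<open>Y > d\<close> shows
\<open>E \<phi>(Y) \<le> p \<phi>(c)\<close>, where \<open>p\<close> is its probability and \<open>c\<close> the conditional mean, while a Cantelli
argument gives \<open>c \<le> \<rho> + \<sigma> sqrt ((1-p)/p)\<close> (lemma \<open>two_point_reduction\<close>); with \<open>\<tau> = c/d\<close> this
contradicts the inequality when \<open>E \<phi>(Y) > \<epsilon>\<close>. The law of \<open>Y\<close> itself is never built. Unimodality of
the law \<open>M\<close> of \<open>a \<bullet> (\<xi> - m)\<close> says that \<open>t\<^bsup>\<alpha>\<^esup> M(B/t) - M(B) \<ge> 0\<close> for \<open>t > 1\<close>, so the normalised
difference is a probability measure (\<open>difference_quotient_law\<close>) whose moments tend to those of \<open>Y\<close>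
as \<open>t \<rightarrow> 1\<close>. A telescoping sum over the scales \<open>t\<^sup>k\<close> bounds the tail of \<open>M\<close> by the integral of
\<open>\<phi>\<close> against it (\<open>tail_le_star_tail\<close>), and \<open>unimodal_tail_bound\<close> passes to the limit.

Necessity. If the inequality fails at \<open>\<tau>\<close> for the mode \<open>m\<close>, take \<open>p = \<epsilon> / (1 - \<tau>\<^bsup>-\<alpha>\<^esup>)\<close> and a
finitely supported \<open>Z\<close> for which \<open>Y\<close> takes the value \<open>c = \<rho> + \<sigma> sqrt ((1-p)/p) > \<tau> d\<close> with
probability \<open>p\<close> (\<open>worst_case_mixture\<close>). The resulting unimodal law violates the constraint with
probability at least \<open>p (1 - (d/c)\<^bsup>\<alpha>\<^esup>) > p (1 - \<tau>\<^bsup>-\<alpha>\<^esup>) = \<epsilon>\<close> (\<open>violating_law\<close>).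
\<close>

section \<open>Square roots of positive definite matrices\<close>

lemma inner_mult_symmetric:
  fixes A :: "real^'n^'n"
  assumes "transpose A = A"
  shows "(A *v x) \<bullet> y = x \<bullet> (A *v y)"
  using assms dot_lmul_matrix[of x A y] transpose_matrix_vector[of A x] by simp

lemma symmetric_if_selfadjoint:
  fixes A :: "real^'n^'n"
  assumes "\<And>x y. (A *v x) \<bullet> y = x \<bullet> (A *v y)"
  shows "transpose A = A"
proof -
  have "x \<bullet> (transpose A *v y) = x \<bullet> (A *v y)" for x y
    using assms[of x y] dot_lmul_matrix[of x "transpose A" y] transpose_matrix_vector[of "transpose A" x] by simp
  then have "transpose A *v y = A *v y" for y
    using vector_eq_ldot by blast
  then show ?thesis by (simp add: matrix_eq)
qed

lemma pos_def_coercive: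
  fixes A :: "real^'n^'n"
  assumes "pos_def A"
  obtains l where "l > 0" "\<And>v. l * (norm v)\<^sup>2 \<le> v \<bullet> (A *v v)"
proof -
  let ?S = "sphere 0 1 :: (real^'n) set"
  have "continuous_on ?S (\<lambda>v. v \<bullet> (A *v v))"
    by (intro continuous_intros linear_continuous_on_compose[where g="(*v) A"]) auto
  moreover have "?S \<noteq> {}" by simp
  ultimately obtain w where w: "w \<in> ?S" "\<And>v. v \<in> ?S \<Longrightarrow> w \<bullet> (A *v w) \<le> v \<bullet> (A *v v)"
    using continuous_attains_inf[of ?S "\<lambda>v. v \<bullet> (A *v v)"] by auto
  have "w \<noteq> 0" using w(1) by auto
  then have pos: "w \<bullet> (A *v w) > 0" using assms by (auto simp: pos_def_def)
  have "(w \<bullet> (A *v w)) * (norm v)\<^sup>2 \<le> v \<bullet> (A *v v)" for v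
  proof (cases "v = 0")
    case False
    then have "w \<bullet> (A *v w) \<le> (v /\<^sub>R norm v) \<bullet> (A *v (v /\<^sub>R norm v))"
      by (intro w) auto
    also have "\<dots> = (v \<bullet> (A *v v)) / (norm v)\<^sup>2"
      by (simp add: matrix_vector_mult_scaleR power2_eq_square divide_inverse)
    finally show ?thesis using False by (simp add: pos_le_divide_eq)
  qed simp
  with pos that show thesis by blast
qed

text \<open>
Rescale \<open>A = c (I - B)\<close> with the norm of \<open>B\<close> at most some \<open>\<beta> < 1\<close>. A square root \<open>sqrt c (I - X)\<close>
corresponds to a fixed point of \<open>X \<mapsto> (B + X\<^sup>2) / 2\<close>, which is a contraction of the ball of radius
\<open>r = 1 - sqrt (1 - \<beta>)\<close>, the smaller root of \<open>\<beta> + r\<^sup>2 = 2 r\<close>. Restricting to self-adjoint operators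
makes the fixed point self-adjoint, and \<open>r < 1\<close> makes the root positive definite.
\<close>

lemma pos_def_sqrt_exists:
  fixes A :: "real^'n^'n"
  assumes A: "pos_def A"
  shows "\<exists>R. pos_def R \<and> R ** R = A"
proof -
  obtain l where l: "l > 0" "\<And>v. l * (norm v)\<^sup>2 \<le> v \<bullet> (A *v v)"
    using pos_def_coercive[OF A] by blast
  obtain K0 where K0: "\<And>v. norm (A *v v) \<le> norm v * K0"
    using bounded_linear.bounded[OF matrix_vector_mul_bounded_linear] by blast
  define K where "K = max K0 l"
  have K: "norm (A *v v) \<le> K * norm v" for v
    using K0[of v] by (smt (verit) K_def mult.commute mult_left_mono norm_ge_zero)
  have Kl: "K \<ge> l" "K > 0" using l by (auto simp: K_def)
  \<comment> \<open>the \<open>c\<close> minimising the bound \<open>1 - 2 l / c + (K / c)\<^sup>2\<close> on the squared norm of \<open>I - A / c\<close>\<close>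
  define c where "c = K\<^sup>2 / l"
  have c: "c > 0" using Kl l by (simp add: c_def)
  define \<beta> where "\<beta> = sqrt (1 - l\<^sup>2 / K\<^sup>2)"
  have lK: "l\<^sup>2 / K\<^sup>2 \<le> 1" "l\<^sup>2 / K\<^sup>2 > 0" using Kl l by (auto simp: field_simps intro!: power_mono)
  have \<beta>: "0 \<le> \<beta>" "\<beta> < 1" using lK by (auto simp: \<beta>_def)
  define B where "B = Blinfun (\<lambda>v. v - (1/c) *\<^sub>R (A *v v))"
  have Bv: "B v = v - (1/c) *\<^sub>R (A *v v)" for v
    unfolding B_def by (subst bounded_linear_Blinfun_apply) (auto intro!: bounded_linear_intros)
  have nB: "norm B \<le> \<beta>"
  proof (rule norm_blinfun_bound)
    fix v
    have "(norm (B v))\<^sup>2 = (norm v)\<^sup>2 - 2 * (1/c) * (v \<bullet> (A *v v)) + (1/c)\<^sup>2 * (norm (A *v v))\<^sup>2"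
      unfolding Bv power2_norm_eq_inner by (simp add: inner_diff inner_commute power2_eq_square)
    also have "\<dots> \<le> (norm v)\<^sup>2 - 2 * (1/c) * (l * (norm v)\<^sup>2) + (1/c)\<^sup>2 * (K * norm v)\<^sup>2"
      using c by (intro add_mono diff_mono mult_left_mono l power_mono K) auto
    also have "\<dots> = (1 - l\<^sup>2 / K\<^sup>2) * (norm v)\<^sup>2"
      using Kl l by (simp add: c_def power2_eq_square field_simps)
    also have "\<dots> = (\<beta> * norm v)\<^sup>2" using lK by (simp add: \<beta>_def power_mult_distrib)
    finally have "(norm (B v))\<^sup>2 \<le> (\<beta> * norm v)\<^sup>2" .
    then show "norm (B v) \<le> \<beta> * norm v"
      by (rule power2_le_imp_le) (use \<beta> in simp)
  qed (use \<beta> in auto)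
  define r where "r = 1 - sqrt (1 - \<beta>)"
  have r: "0 \<le> r" "r < 1" using \<beta> by (auto simp: r_def)
  have r2: "r\<^sup>2 = 2 * r - \<beta>" using \<beta> by (simp add: r_def power2_eq_square algebra_simps)
  define S where "S = {X :: (real^'n) \<Rightarrow>\<^sub>L (real^'n). norm X \<le> r} \<inter> {X :: (real^'n) \<Rightarrow>\<^sub>L (real^'n). \<forall>u v. X u \<bullet> v = u \<bullet> X v}"
  define f where "f X = ((1/2) :: real) *\<^sub>R (B + (X o\<^sub>L X))" for X
  have fv: "f X v = (1/2) *\<^sub>R (B v + X (X v))" for X v
    by (simp add: f_def blinfun.scaleR_left blinfun.add_left)
  have "closed S"
    unfolding S_def
    by (intro closed_Int closed_Collect_le closed_Collect_all closed_Collect_eq continuous_intros)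
  then have "Topological_Spaces.complete S" by (simp add: complete_eq_closed)
  moreover have "0 \<in> S" using r by (simp add: S_def)
  moreover have "f ` S \<subseteq> S"
  proof safe
    fix X assume X: "X \<in> S"
    have nX: "norm X \<le> r" and sX: "\<And>u v. X u \<bullet> v = u \<bullet> X v" using X by (auto simp: S_def)
    have "norm (X o\<^sub>L X) \<le> r\<^sup>2"
      using norm_blinfun_compose[of X X] mult_mono[OF nX nX] r by (simp add: power2_eq_square)
    then have "norm (B + (X o\<^sub>L X)) \<le> \<beta> + r\<^sup>2"
      using nB norm_triangle_ineq[of B "X o\<^sub>L X"] by linarith
    then have "norm (f X) \<le> r" by (simp add: f_def r2)
    moreover have "f X u \<bullet> v = u \<bullet> f X v" for u v
      using A by (simp add: fv Bv sX inner_add inner_diff pos_def_def inner_mult_symmetric)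
    ultimately show "f X \<in> S" by (simp add: S_def)
  qed
  moreover have "dist (f X) (f Y) \<le> r * dist X Y" if "X \<in> S" "Y \<in> S" for X Y
  proof -
    have nX: "norm X \<le> r" and nY: "norm Y \<le> r" using that by (auto simp: S_def)
    have "f X - f Y = (1/2) *\<^sub>R ((X o\<^sub>L (X - Y)) + ((X - Y) o\<^sub>L Y))"
      by (rule blinfun_eqI)
         (simp add: fv blinfun.diff_left blinfun.diff_right blinfun.add_left blinfun.scaleR_left algebra_simps)
    then have "dist (f X) (f Y) = norm ((X o\<^sub>L (X - Y)) + ((X - Y) o\<^sub>L Y)) / 2"
      by (simp add: dist_norm)
    also have "\<dots> \<le> (norm (X o\<^sub>L (X - Y)) + norm ((X - Y) o\<^sub>L Y)) / 2"
      by (intro divide_right_mono norm_triangle_ineq) auto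
    also have "\<dots> \<le> (norm X * norm (X - Y) + norm (X - Y) * norm Y) / 2"
      by (intro divide_right_mono add_mono norm_blinfun_compose) auto
    also have "\<dots> \<le> (r * norm (X - Y) + norm (X - Y) * r) / 2"
      using nX nY by (intro divide_right_mono add_mono mult_right_mono mult_left_mono) auto
    finally show ?thesis by (simp add: dist_norm)
  qed
  ultimately have "\<exists>!X\<in>S. f X = X"
    using r by (intro Banach_fix[of S r f]) auto
  then obtain X where X: "X \<in> S" "f X = X" by blast
  then have nX: "norm X \<le> r" and sX: "\<And>u v. X u \<bullet> v = u \<bullet> X v" by (auto simp: S_def)
  have XX: "X (X v) = 2 *\<^sub>R X v - B v" for v
  proof -
    have "X v = (1/2) *\<^sub>R (B v + X (X v))" using X(2) fv[of X v] by simp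
    then have "2 *\<^sub>R X v = B v + X (X v)" by (metis scaleR_half_double scaleR_2 scaleR_add_right)
    then show ?thesis by simp
  qed
  define R where "R = matrix (\<lambda>v. sqrt c *\<^sub>R (v - X v))"
  have Rv: "R *v v = sqrt c *\<^sub>R (v - X v)" for v
    unfolding R_def by (rule matrix_works)
      (auto intro!: linearI simp: linear_matrix_vector_mul_eq blinfun.add_right blinfun.scaleR_right algebra_simps)
  have "R *v (R *v v) = A *v v" for v
  proof -
    have "R *v (R *v v) = (sqrt c * sqrt c) *\<^sub>R ((v - X v) - X (v - X v))"
      by (simp only: Rv blinfun.scaleR_right blinfun.diff_right scaleR_diff_right scaleR_scaleR)
    also have "\<dots> = c *\<^sub>R (v - B v)"
      using c by (simp add: blinfun.diff_right XX scaleR_2)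
    also have "\<dots> = A *v v" using c by (simp add: Bv)
    finally show ?thesis .
  qed
  then have "R ** R = A" by (simp add: matrix_eq flip: matrix_vector_mul_assoc)
  moreover have "pos_def R"
    unfolding pos_def_def
  proof (intro conjI allI impI)
    show "transpose R = R"
      by (rule symmetric_if_selfadjoint) (simp add: Rv inner_diff sX)
    fix v :: "real^'n" assume v: "v \<noteq> 0"
    have "v \<bullet> X v \<le> norm v * norm (X v)" by (rule norm_cauchy_schwarz)
    also have "\<dots> \<le> norm v * (r * norm v)"
      using norm_blinfun[of X v] mult_right_mono[OF nX, of "norm v"]
      by (intro mult_left_mono) auto
    also have "\<dots> < 1 * (norm v * norm v)"
      using r v by (simp add: mult.left_commute)
    finally have "v \<bullet> X v < v \<bullet> v" by (simp add: power2_norm_eq_inner flip: power2_eq_square)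
    then show "0 < v \<bullet> (R *v v)" using c by (simp add: Rv inner_diff)
  qed
  ultimately show ?thesis by blast
qed

lemma trace_sandwich:
  fixes D M :: "real^'n^'n"
  assumes "transpose D = D"
  shows "trace (D ** M ** D) = (\<Sum>i\<in>UNIV. (D *v axis i 1) \<bullet> (M *v (D *v axis i 1)))"
proof -
  have "(D ** M ** D) $ i $ i = (D *v axis i 1) \<bullet> (M *v (D *v axis i 1))" for i
  proof -
    have "(D ** M ** D) $ i $ i = axis i 1 \<bullet> ((D ** M ** D) *v axis i 1)"
      by (simp add: inner_axis' matrix_vector_mult_basis column_def)
    also have "\<dots> = axis i 1 \<bullet> (D *v (M *v (D *v axis i 1)))"
      by (simp add: matrix_vector_mul_assoc matrix_mul_assoc)
    finally show ?thesis using inner_mult_symmetric[OF assms] by metis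
  qed
  then show ?thesis by (simp add: trace_def)
qed

text \<open>
The difference \<open>D\<close> of two roots satisfies \<open>D R + S D = R\<^sup>2 - S\<^sup>2 = 0\<close>. Multiplying by \<open>D\<close> and
taking traces gives \<open>tr (D R D) + tr (D S D) = 0\<close>, a sum of nonnegative terms.
\<close>

lemma pos_def_sqrt_unique:
  fixes R S :: "real^'n^'n"
  assumes R: "pos_def R" and S: "pos_def S" and eq: "R ** R = S ** S"
  shows "R = S"
proof -
  define D where "D = R - S"
  have D: "transpose D = D" using R S by (simp add: D_def pos_def_def transpose_def vec_eq_iff)
  have nn: "0 \<le> v \<bullet> (R *v v)" "0 \<le> v \<bullet> (S *v v)" for v
    using R S by (cases "v = 0"; force simp: pos_def_def)+
  have "D ** R + S ** D = 0"
  proof -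
    have RS: "R *v (R *v x) = S *v (S *v x)" for x
      by (simp add: matrix_vector_mul_assoc eq)
    have "(D ** R + S ** D) *v x = 0 *v x" for x
      by (simp add: D_def matrix_vector_mult_add_rdistrib matrix_vector_mult_diff_rdistrib
          matrix_vector_mult_diff_distrib RS flip: matrix_vector_mul_assoc)
    then show ?thesis unfolding matrix_eq by blast
  qed
  moreover have "(D ** R + S ** D) ** D = D ** R ** D + S ** D ** D"
    by (simp add: matrix_eq matrix_vector_mult_add_rdistrib flip: matrix_vector_mul_assoc)
  ultimately have "D ** R ** D + S ** D ** D = 0" by simp
  then have "trace (D ** R ** D) + trace (S ** D ** D) = 0"
    by (metis trace_add trace_0 mat_0)
  moreover have "trace (S ** D ** D) = trace (D ** S ** D)"
    by (metis matrix_mul_assoc trace_mul_sym)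
  moreover have "trace (D ** R ** D) \<ge> 0" "trace (D ** S ** D) \<ge> 0"
    unfolding trace_sandwich[OF D] by (intro sum_nonneg nn)+
  ultimately have "(\<Sum>i\<in>UNIV. (D *v axis i 1) \<bullet> (R *v (D *v axis i 1))) = 0"
    unfolding trace_sandwich[OF D] by linarith
  then have "(D *v axis i 1) \<bullet> (R *v (D *v axis i 1)) = 0" for i
    using nn by (subst (asm) sum_nonneg_eq_0_iff) auto
  then have "D *v axis i 1 = 0" for i
    using R by (metis less_irrefl pos_def_def)
  then have "column i D = 0" for i by (simp add: matrix_vector_mult_basis)
  then have "D = 0" by (simp add: column_def vec_eq_iff)
  then show ?thesis by (simp add: D_def)
qed

lemma mat_sqrt_props:
  assumes "pos_def A"
  shows "pos_def (mat_sqrt A)" "mat_sqrt A ** mat_sqrt A = A"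
proof -
  have "\<exists>!R. pos_def R \<and> R ** R = A"
    using pos_def_sqrt_exists[OF assms] pos_def_sqrt_unique by metis
  from theI'[OF this] show "pos_def (mat_sqrt A)" "mat_sqrt A ** mat_sqrt A = A"
    unfolding mat_sqrt_def by auto
qed

section \<open>Tails of unimodal laws on the line\<close>

lemma nn_integral_add_measures:
  assumes sets: "sets A = sets C" "sets B = sets C"
    and add: "\<And>S. S \<in> sets C \<Longrightarrow> emeasure C S = emeasure A S + emeasure B S"
    and f: "f \<in> borel_measurable C"
  shows "(\<integral>\<^sup>+x. f x \<partial>C) = (\<integral>\<^sup>+x. f x \<partial>A) + (\<integral>\<^sup>+x. f x \<partial>B)"
  using f
proof (induction rule: borel_measurable_induct)
  case (cong f g)
  have "space A = space C" "space B = space C" using sets by (auto dest: sets_eq_imp_space_eq)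
  with cong show ?case by (metis (mono_tags, lifting) nn_integral_cong)
next
  case (set S)
  then show ?case using add sets by simp
next
  case (mult u c)
  have "u \<in> borel_measurable A" "u \<in> borel_measurable B"
    using mult(2) sets by (auto cong: measurable_cong_sets)
  with mult show ?case by (simp add: nn_integral_cmult distrib_left)
next
  case (add u v)
  have "u \<in> borel_measurable A" "u \<in> borel_measurable B" "v \<in> borel_measurable A" "v \<in> borel_measurable B"
    using add sets by (auto cong: measurable_cong_sets)
  with add show ?case by (simp add: nn_integral_add add_ac)
next
  case (seq U)
  have m: "U i \<in> borel_measurable A" "U i \<in> borel_measurable B" for i
    using seq sets by (auto cong: measurable_cong_sets)
  have inc: "incseq (\<lambda>i. integral\<^sup>N M (U i))" for M
    using seq(3) by (auto simp: incseq_def le_fun_def intro!: nn_integral_mono)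
  have "(\<integral>\<^sup>+x. (SUP i. U i x) \<partial>C) = (SUP i. integral\<^sup>N C (U i))"
    using seq by (intro nn_integral_monotone_convergence_SUP) auto
  also have "\<dots> = (SUP i. integral\<^sup>N A (U i) + integral\<^sup>N B (U i))"
    using seq by simp
  also have "\<dots> = (SUP i. integral\<^sup>N A (U i)) + (SUP i. integral\<^sup>N B (U i))"
    by (intro ennreal_SUP_add inc)
  also have "\<dots> = (\<integral>\<^sup>+x. (SUP i. U i x) \<partial>A) + (\<integral>\<^sup>+x. (SUP i. U i x) \<partial>B)"
    using seq m by (simp add: nn_integral_monotone_convergence_SUP)
  finally show ?case by (simp add: SUP_apply[abs_def] image_comp)
qed

lemma integral_add_measures:
  fixes f :: "'a \<Rightarrow> real"
  assumes sets: "sets A = sets C" "sets B = sets C"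
    and add: "\<And>S. S \<in> sets C \<Longrightarrow> emeasure C S = emeasure A S + emeasure B S"
    and f: "integrable C f"
  shows "integrable A f" "integrable B f" "(\<integral>x. f x \<partial>C) = (\<integral>x. f x \<partial>A) + (\<integral>x. f x \<partial>B)"
proof -
  have m: "f \<in> borel_measurable C" using f by auto
  then have mA: "f \<in> borel_measurable A" and mB: "f \<in> borel_measurable B"
    using sets by (auto cong: measurable_cong_sets)
  note nn = nn_integral_add_measures[OF sets add]
  have n: "(\<integral>\<^sup>+x. ennreal (norm (f x)) \<partial>C) = (\<integral>\<^sup>+x. ennreal (norm (f x)) \<partial>A) + (\<integral>\<^sup>+x. ennreal (norm (f x)) \<partial>B)"
    using m by (intro nn) auto
  show A: "integrable A f" and B: "integrable B f"
    using f n mA mB unfolding integrable_iff_bounded by auto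
  have p: "(\<integral>\<^sup>+x. ennreal (f x) \<partial>C) = (\<integral>\<^sup>+x. ennreal (f x) \<partial>A) + (\<integral>\<^sup>+x. ennreal (f x) \<partial>B)"
    and q: "(\<integral>\<^sup>+x. ennreal (- f x) \<partial>C) = (\<integral>\<^sup>+x. ennreal (- f x) \<partial>A) + (\<integral>\<^sup>+x. ennreal (- f x) \<partial>B)"
    using m by (auto intro!: nn)
  have "(\<integral>\<^sup>+x. ennreal (f x) \<partial>A) < \<infinity>" "(\<integral>\<^sup>+x. ennreal (f x) \<partial>B) < \<infinity>"
       "(\<integral>\<^sup>+x. ennreal (- f x) \<partial>A) < \<infinity>" "(\<integral>\<^sup>+x. ennreal (- f x) \<partial>B) < \<infinity>"
    using A B by (auto simp: real_integrable_def top.not_eq_extremum)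
  then show "(\<integral>x. f x \<partial>C) = (\<integral>x. f x \<partial>A) + (\<integral>x. f x \<partial>B)"
    unfolding real_lebesgue_integral_def[OF f] real_lebesgue_integral_def[OF A] real_lebesgue_integral_def[OF B] p q
    by (simp add: enn2real_plus)
qed

text \<open>
The law of the mixing variable in the radial representation is the derivative of \<open>t\<^bsup>\<alpha>\<^esup> M(B/t)\<close>
at \<open>t = 1\<close>, divided by \<open>\<alpha>\<close>. The difference quotient at \<open>t > 1\<close> approximates it and is
already a probability measure: unimodality is exactly its nonnegativity, and its total mass before
normalisation is \<open>t\<^bsup>\<alpha>\<^esup> - 1\<close>.
\<close>

lemma difference_quotient_law:
  fixes M :: "real measure"
  assumes M: "prob_space M" "sets M = sets borel" and t: "t > 1" and \<alpha>: "\<alpha> > 0"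
    and uni: "\<And>B. B \<in> sets borel \<Longrightarrow> measure M B \<le> t powr \<alpha> * measure M {x. t * x \<in> B}"
  obtains \<nu> where "prob_space \<nu>" "sets \<nu> = sets borel"
    "\<And>f :: real \<Rightarrow> real. integrable M f \<Longrightarrow> integrable M (\<lambda>x. f (t * x)) \<Longrightarrow>
      integrable \<nu> f \<and> (t powr \<alpha> - 1) * (\<integral>x. f x \<partial>\<nu>) = t powr \<alpha> * (\<integral>x. f (t * x) \<partial>M) - (\<integral>x. f x \<partial>M)"
proof -
  interpret prob_space M by fact
  note [measurable_cong] = M(2)
  have spM: "space M = UNIV" using M(2) by (metis sets_eq_imp_space_eq space_borel)
  define D where "D = distr M borel ((*) t)"
  define T where "T = density D (\<lambda>_. ennreal (t powr \<alpha>))"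
  define \<delta> where "\<delta> = diff_measure T M"
  define N where "N = t powr \<alpha> - 1"
  have N: "N > 0" using t \<alpha> by (simp add: N_def)
  have sT[measurable_cong]: "sets T = sets borel" by (simp add: T_def D_def)
  have sD: "sets D = sets borel" by (simp add: D_def)
  have spT: "space T = UNIV" by (simp add: T_def D_def)
  have s\<delta>: "sets \<delta> = sets borel" by (simp add: \<delta>_def sT)
  have eT: "emeasure T B = ennreal (t powr \<alpha> * measure M {x. t * x \<in> B})" if "B \<in> sets borel" for B
  proof -
    have [measurable]: "B \<in> sets borel" by fact
    have "emeasure T B = t powr \<alpha> * emeasure D B"
      unfolding T_def using that by (subst emeasure_density_const) (auto simp: D_def)
    also have "emeasure D B = emeasure M {x. t * x \<in> B}"
      unfolding D_def by (subst emeasure_distr) (auto simp: spM vimage_def)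
    finally show ?thesis by (simp add: emeasure_eq_measure ennreal_mult)
  qed
  have le: "emeasure M B \<le> emeasure T B" if "B \<in> sets T" for B
    using uni that by (auto simp: sT eT emeasure_eq_measure intro!: ennreal_leI)
  have finT: "finite_measure T"
    by (rule finite_measureI) (simp add: spT eT)
  have e\<delta>: "emeasure \<delta> B = emeasure T B - emeasure M B" if "B \<in> sets T" for B
    unfolding \<delta>_def using M(2) le that finT
    by (intro emeasure_diff_measure) (auto simp: sT finite_measure_axioms)
  have add: "emeasure T S = emeasure \<delta> S + emeasure M S" if "S \<in> sets T" for S
    using le[OF that] that by (simp add: e\<delta> diff_add_cancel_ennreal)
  define \<nu> where "\<nu> = density \<delta> (\<lambda>_. ennreal (1/N))"
  have s\<nu>: "sets \<nu> = sets borel" by (simp add: \<nu>_def s\<delta>)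
  have main: "integrable \<nu> f \<and> N * (\<integral>x. f x \<partial>\<nu>) = t powr \<alpha> * (\<integral>x. f (t * x) \<partial>M) - (\<integral>x. f x \<partial>M)"
    if f: "integrable M f" and ft: "integrable M (\<lambda>x. f (t * x))" for f :: "real \<Rightarrow> real"
  proof -
    have fm[measurable]: "f \<in> borel_measurable borel" using f M(2)
      by (metis borel_measurable_integrable measurable_cong_sets)
    have "integrable D f"
      unfolding D_def using ft by (subst integrable_distr_eq) auto
    then have T: "integrable T f"
      unfolding T_def using fm sD by (subst integrable_density) (auto cong: measurable_cong_sets)
    have iT: "(\<integral>x. f x \<partial>T) = t powr \<alpha> * (\<integral>x. f (t * x) \<partial>M)"
      unfolding T_def using fm sD
      by (subst integral_density) (auto simp: D_def integral_distr cong: measurable_cong_sets)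
    have sets: "sets \<delta> = sets T" "sets M = sets T" using s\<delta> sT M(2) by auto
    note L = integral_add_measures[OF sets add T]
    have fd: "f \<in> borel_measurable \<delta>" using fm s\<delta> by (auto cong: measurable_cong_sets)
    have "integrable \<nu> f"
      unfolding \<nu>_def using fd L N by (subst integrable_density) auto
    moreover have "(\<integral>x. f x \<partial>\<nu>) = (1/N) * (\<integral>x. f x \<partial>\<delta>)"
      unfolding \<nu>_def using fd N by (subst integral_density) auto
    ultimately show ?thesis using L(3) iT N by auto
  qed
  have "emeasure \<nu> (space \<nu>) = 1"
  proof -
    have sp: "space \<delta> = UNIV" by (simp add: \<delta>_def spT)
    have "emeasure \<nu> (space \<nu>) = ennreal (1/N) * emeasure \<delta> UNIV"
      unfolding \<nu>_def using sp s\<delta> by (simp add: emeasure_density_const)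
    also have "emeasure \<delta> UNIV = ennreal N"
    proof -
      have U: "UNIV \<in> sets T" by (simp add: sT)
      have "measure M UNIV = 1" using prob_space spM by simp
      then show ?thesis
        using prob_space N unfolding e\<delta>[OF U] by (simp add: eT N_def emeasure_eq_measure ennreal_minus flip: ennreal_1)
    qed
    finally show ?thesis using N by (simp flip: ennreal_mult)
  qed
  then have "prob_space \<nu>" by (rule prob_spaceI)
  with s\<nu> main that show thesis unfolding N_def by blast
qed

text \<open>
The map \<open>y \<mapsto> (d/y)\<^bsup>\<alpha>\<^esup>\<close> is convex, hence lies above its tangent at \<open>c\<close>; integrated over the event
\<open>y > d\<close> with \<open>c\<close> the conditional mean, this is Jensen's inequality.
\<close>

lemma powr_tangent_bound:
  fixes c y \<alpha> d :: real
  assumes "0 < c" "0 < y" "0 \<le> d" "0 < \<alpha>"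
  shows "(d / c) powr \<alpha> * (1 - \<alpha> * (y - c) / c) \<le> (d / y) powr \<alpha>"
proof -
  have "1 - \<alpha> * (y - c) / c \<le> 1 - \<alpha> * ln (y / c)"
  proof -
    have "\<alpha> * ln (y / c) \<le> \<alpha> * (y / c - 1)"
      using assms by (intro mult_left_mono ln_le_minus_one) auto
    then show ?thesis using assms by (simp add: field_simps)
  qed
  also have "\<dots> \<le> exp (- \<alpha> * ln (y / c))"
    using exp_ge_add_one_self[of "- \<alpha> * ln (y / c)"] by simp
  also have "\<dots> = (c / y) powr \<alpha>"
    using assms by (simp add: powr_def ln_div algebra_simps)
  finally have "(d / c) powr \<alpha> * (1 - \<alpha> * (y - c) / c) \<le> (d / c) powr \<alpha> * (c / y) powr \<alpha>"
    by (intro mult_left_mono) auto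
  also have "\<dots> = (d / y) powr \<alpha>"
    using assms by (simp flip: powr_mult)
  finally show ?thesis .
qed

text \<open>
The probability that \<open>U\<^bsup>1/\<alpha>\<^esup> y\<close> exceeds \<open>d\<close>, for \<open>U\<close> uniform on the unit interval.
\<close>

definition star_tail :: "real \<Rightarrow> real \<Rightarrow> real \<Rightarrow> real" where
  "star_tail \<alpha> d y = (if d < y then 1 - (d / y) powr \<alpha> else 0)"

lemma star_tail_measurable [measurable]: "star_tail \<alpha> d \<in> borel_measurable borel"
  unfolding star_tail_def[abs_def] by measurable

lemma star_tail_bounds:
  assumes "d \<ge> 0" "\<alpha> > 0"
  shows "0 \<le> star_tail \<alpha> d y" "star_tail \<alpha> d y \<le> 1"
proof -
  have "(d / y) powr \<alpha> \<le> 1" if "d < y"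
    using that assms by (intro powr_le1) auto
  then show "0 \<le> star_tail \<alpha> d y" "star_tail \<alpha> d y \<le> 1"
    by (auto simp: star_tail_def)
qed

text \<open>
Concentrating the mass above \<open>d\<close> at its conditional mean \<open>c\<close> increases the integral of
\<open>star_tail\<close> to at most \<open>p (1 - (d/c)\<^bsup>\<alpha>\<^esup>)\<close>, so \<open>e \<le> p (1 - (d/c)\<^bsup>\<alpha>\<^esup>)\<close>, which bounds the odds
\<open>(1-p)/p\<close> from above; the variance bounds how far \<open>c\<close> can lie above \<open>\<rho>\<close> in terms of these odds.
\<close>

lemma two_point_reduction:
  fixes \<nu> :: "real measure"
  assumes \<nu>: "prob_space \<nu>" "sets \<nu> = sets borel"
    and i1: "integrable \<nu> (\<lambda>y. y)" and m1: "(\<integral>y. y \<partial>\<nu>) = \<rho>"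
    and i2: "integrable \<nu> (\<lambda>y. y\<^sup>2)" and m2: "(\<integral>y. y\<^sup>2 \<partial>\<nu>) = \<rho>\<^sup>2 + \<sigma>\<^sup>2"
    and \<sigma>: "\<sigma> > 0" and d: "d \<ge> 0" and \<alpha>: "\<alpha> > 0"
    and e: "0 < e" "e \<le> (\<integral>y. star_tail \<alpha> d y \<partial>\<nu>)"
  obtains y where "d < y" "(d / y) powr \<alpha> \<le> 1 - e" "y \<le> \<rho> + \<sigma> * sqrt ((1 - e - (d / y) powr \<alpha>) / e)"
proof -
  interpret prob_space \<nu> by fact
  note [measurable_cong] = \<nu>(2)
  have sp: "space \<nu> = UNIV" using \<nu>(2) by (metis sets_eq_imp_space_eq space_borel)
  define I :: "real \<Rightarrow> real" where "I = indicator {d<..}"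
  have I01: "I y = 0 \<or> I y = 1" for y by (auto simp: I_def indicator_def)
  have [measurable]: "I \<in> borel_measurable borel" by (simp add: I_def)
  define p where "p = (\<integral>y. I y \<partial>\<nu>)"
  have bI: "integrable \<nu> I"
    by (rule integrable_const_bound[where B=1]) (auto simp: I_def)
  have iy: "integrable \<nu> (\<lambda>y. I y * y)"
    by (rule Bochner_Integration.integrable_bound[OF i1]) (auto simp: I_def indicator_def)
  have bT: "integrable \<nu> (star_tail \<alpha> d)"
    by (rule integrable_const_bound[where B=1]) (use star_tail_bounds[OF d \<alpha>] in auto)
  have TI: "star_tail \<alpha> d y \<le> I y" for y
    using star_tail_bounds[OF d \<alpha>, of y] by (auto simp: I_def star_tail_def indicator_def)
  have "(\<integral>y. star_tail \<alpha> d y \<partial>\<nu>) \<le> p"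
    unfolding p_def by (intro integral_mono bT bI TI)
  with e have p: "e \<le> p" "p > 0" by auto
  have p1: "p \<le> 1"
    unfolding p_def I_def by (simp add: sp)
  define c where "c = (\<integral>y. I y * y \<partial>\<nu>) / p"
  have Iy: "(\<integral>y. I y * y \<partial>\<nu>) = p * c" using p by (simp add: c_def)
  have "c > d"
  proof -
    have nn: "0 \<le> I y * y - d * I y" for y by (auto simp: I_def indicator_def)
    have int: "integrable \<nu> (\<lambda>y. I y * y - d * I y)" using iy bI by auto
    have eq: "(\<integral>y. I y * y - d * I y \<partial>\<nu>) = p * c - d * p"
      using iy bI by (simp add: Iy p_def)
    have "(\<integral>y. I y * y - d * I y \<partial>\<nu>) \<noteq> 0"
    proof
      assume "(\<integral>y. I y * y - d * I y \<partial>\<nu>) = 0"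
      then have "AE y in \<nu>. I y * y - d * I y = 0"
        using integral_nonneg_eq_0_iff_AE[OF int] nn by auto
      then have "AE y in \<nu>. I y = 0"
        by eventually_elim (auto simp: I_def indicator_def split: if_splits)
      then have "p = 0" unfolding p_def by (rule integral_eq_zero_AE)
      with p show False by simp
    qed
    moreover have "0 \<le> (\<integral>y. I y * y - d * I y \<partial>\<nu>)" by (rule integral_nonneg_AE) (use nn in auto)
    ultimately have "0 < p * (c - d)" unfolding eq by (metis less_eq_real_def mult.commute right_diff_distrib)
    with p show ?thesis by (simp add: zero_less_mult_iff)
  qed
  with d have c: "c > 0" by simp
  define s where "s = (d / c) powr \<alpha>"
  have s0: "s \<ge> 0" by (simp add: s_def)
  have "e \<le> p * (1 - s)"
  proof -
    have "star_tail \<alpha> d y \<le> (1 - s - s * \<alpha>) * I y + s * \<alpha> / c * (I y * y)" for y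
    proof (cases "d < y")
      case True
      have "s * (1 - \<alpha> * (y - c) / c) \<le> (d / y) powr \<alpha>"
        unfolding s_def using True d c \<alpha> by (intro powr_tangent_bound) auto
      moreover have "(1 - s - s * \<alpha>) + s * \<alpha> / c * y = 1 - s * (1 - \<alpha> * (y - c) / c)"
        using c by (simp add: field_simps)
      ultimately show ?thesis using True by (simp add: star_tail_def I_def)
    qed (auto simp: star_tail_def I_def)
    then have "(\<integral>y. star_tail \<alpha> d y \<partial>\<nu>) \<le> (\<integral>y. (1 - s - s * \<alpha>) * I y + s * \<alpha> / c * (I y * y) \<partial>\<nu>)"
      using bI iy by (intro integral_mono bT) auto
    also have "\<dots> = (1 - s - s * \<alpha>) * p + s * \<alpha> / c * (p * c)"
      using bI iy by (simp add: Iy p_def)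
    also have "\<dots> = p * (1 - s)" using c by (simp add: field_simps)
    finally show ?thesis using e by simp
  qed
  note eps = this
  have s1: "1 - s > 0" using eps e p by (metis less_le_trans zero_less_mult_pos)
  have "p * (1 - s) \<le> 1 * (1 - s)" using p1 s1 by (intro mult_right_mono) auto
  from order_trans[OF eps this] have s2: "s \<le> 1 - e" by simp
  have q: "(1 - p) / p \<le> (1 - e - s) / e"
    using eps p e by (simp add: field_simps)
  have cant: "c \<le> \<rho> + \<sigma> * sqrt ((1 - p) / p)"
  proof (cases "c \<le> \<rho>")
    case True
    then show ?thesis using \<sigma> p1 p by (simp add: add_increasing2)
  next
    case False
    \<comment> \<open>the minimiser over \<open>l\<close> of the second moment of \<open>l (y - \<rho>) - (I y - p)\<close>, so that its
      nonnegativity becomes the Cauchy--Schwarz inequality\<close>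
    define l where "l = p * (c - \<rho>) / \<sigma>\<^sup>2"
    have iI2: "I y * I y = I y" for y using I01[of y] by auto
    have ex: "(l * (y - \<rho>) - (I y - p))\<^sup>2 = l\<^sup>2 * y\<^sup>2 + (2 * l * p - 2 * l\<^sup>2 * \<rho>) * y - 2 * l * (I y * y)
        + (2 * l * \<rho> + 1 - 2 * p) * I y + (l\<^sup>2 * \<rho>\<^sup>2 - 2 * l * \<rho> * p + p\<^sup>2)" for y
      using I01[of y] by (auto simp: power2_eq_square algebra_simps)
    have "0 \<le> (\<integral>y. (l * (y - \<rho>) - (I y - p))\<^sup>2 \<partial>\<nu>)" by simp
    also have "\<dots> = l\<^sup>2 * (\<rho>\<^sup>2 + \<sigma>\<^sup>2) + (2 * l * p - 2 * l\<^sup>2 * \<rho>) * \<rho> - 2 * l * (p * c)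
        + (2 * l * \<rho> + 1 - 2 * p) * p + (l\<^sup>2 * \<rho>\<^sup>2 - 2 * l * \<rho> * p + p\<^sup>2)"
      unfolding ex using bI iy i1 i2 prob_space by (simp add: Iy m1 m2 flip: p_def)
    also have "\<dots> = l\<^sup>2 * \<sigma>\<^sup>2 - 2 * l * p * (c - \<rho>) + p * (1 - p)"
      by (simp add: power2_eq_square algebra_simps)
    also have "l\<^sup>2 * \<sigma>\<^sup>2 = (p * (c - \<rho>) / \<sigma>)\<^sup>2"
      using \<sigma> by (simp add: l_def power2_eq_square)
    also have "2 * l * p * (c - \<rho>) = 2 * (p * (c - \<rho>) / \<sigma>)\<^sup>2"
      by (simp add: l_def power2_eq_square)
    finally have "(p * (c - \<rho>) / \<sigma>)\<^sup>2 \<le> p * (1 - p)" by simp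
    moreover have "p * (c - \<rho>) / \<sigma> = ((c - \<rho>) / \<sigma>) * p" by simp
    ultimately have "((c - \<rho>) / \<sigma>)\<^sup>2 * p\<^sup>2 \<le> p * (1 - p)" by (metis power_mult_distrib)
    then have "((c - \<rho>) / \<sigma>)\<^sup>2 * p * p \<le> (1 - p) * p" by (simp add: power2_eq_square mult.assoc mult.commute)
    then have "((c - \<rho>) / \<sigma>)\<^sup>2 \<le> (1 - p) / p" using p by (simp add: pos_le_divide_eq)
    then have "(c - \<rho>) / \<sigma> \<le> sqrt ((1 - p) / p)" by (rule real_le_rsqrt)
    then show ?thesis using \<sigma> by (simp add: field_simps)
  qed
  also have "\<dots> \<le> \<rho> + \<sigma> * sqrt ((1 - e - s) / e)"
    using q \<sigma> by simp
  finally show thesis using \<open>c > d\<close> s2 by (intro that[of c]) (auto simp: s_def)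
qed

text \<open>
With \<open>q = t\<^bsup>-\<alpha>\<^esup>\<close> each term is \<open>q\<^sup>k\<^sup>-\<^sup>1 - q\<^sup>k\<close>, so if \<open>K\<close> is the last scale with \<open>t\<^sup>K d < y\<close> the sum
is at most \<open>1 - q\<^sup>K\<close>, and \<open>q\<^sup>K \<ge> (d/y)\<^bsup>\<alpha>\<^esup>\<close> by the choice of \<open>K\<close>.
\<close>

lemma tail_telescope:
  fixes t \<alpha> d y :: real
  assumes t: "t > 1" and \<alpha>: "\<alpha> > 0" and d: "d \<ge> 0"
  shows "(\<Sum>k=1..n. (t powr \<alpha> - 1) * (1 / t powr \<alpha>) ^ k * indicator {t ^ k * d<..} y) \<le> star_tail \<alpha> d y"
proof (cases "d < y")
  case False
  have "indicator {t ^ k * d<..} y = (0::real)" for k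
  proof -
    have "1 * d \<le> t ^ k * d" using t d by (intro mult_right_mono) auto
    with False show ?thesis by auto
  qed
  with False show ?thesis by (simp add: star_tail_def)
next
  case True
  define q where "q = 1 / t powr \<alpha>"
  have tp: "t powr \<alpha> > 1" using t \<alpha> by simp
  have q: "q > 0" "q < 1" using tp by (auto simp: q_def divide_simps)
  define N where "N = t powr \<alpha> - 1"
  have Nq: "N * q = 1 - q" using tp t by (simp add: N_def q_def diff_divide_distrib)
  have qk: "(d / y) powr \<alpha> \<le> q ^ k" if "t ^ k * d < y" for k
  proof -
    have "d / y \<le> (1 / t) ^ k" using that True d t by (simp add: field_simps power_divide)
    then have "(d / y) powr \<alpha> \<le> ((1 / t) ^ k) powr \<alpha>"
      using True d \<alpha> by (intro powr_mono2) auto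
    also have "\<dots> = q ^ k"
      using t by (simp add: q_def powr_divide power_divide powr_power powr_realpow[symmetric] powr_powr mult.commute)
    finally show ?thesis .
  qed
  have "(\<Sum>k=1..n. N * q ^ k * indicator {t ^ k * d<..} y) \<le> 1 - q ^ n
     \<and> (\<Sum>k=1..n. N * q ^ k * indicator {t ^ k * d<..} y) \<le> 1 - (d / y) powr \<alpha>"
  proof (induction n)
    case 0
    then show ?case using qk[of 0] True by simp
  next
    case (Suc n)
    have st: "N * q ^ Suc n = q ^ n - q ^ Suc n"
      using Nq by (metis (no_types, lifting) left_diff_distrib mult.assoc mult.commute mult_1 power_Suc)
    have "q ^ Suc n \<le> q ^ n" using q by (intro power_decreasing) auto
    then show ?case
      using Suc st qk[of "Suc n"] by (cases "t ^ Suc n * d < y") auto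
  qed
  then show ?thesis using True by (simp add: star_tail_def N_def q_def)
qed

text \<open>
Applying the defining property of \<open>\<nu>\<close> to the half-lines above \<open>t\<^sup>k d\<close> expresses the tail of \<open>M\<close>
at \<open>t\<^sup>k d\<close> through the one at \<open>t\<^sup>k\<^sup>+\<^sup>1 d\<close>; iterating leaves a remainder of at most \<open>t\<^sup>-\<^sup>\<alpha>\<^sup>n\<close>.
\<close>

lemma tail_le_star_tail:
  fixes M \<nu> :: "real measure"
  assumes M: "prob_space M" "sets M = sets borel" and \<nu>: "prob_space \<nu>" "sets \<nu> = sets borel"
    and t: "t > 1" and \<alpha>: "\<alpha> > 0" and d: "d \<ge> 0"
    and diff: "\<And>f :: real \<Rightarrow> real. integrable M f \<Longrightarrow> integrable M (\<lambda>x. f (t * x)) \<Longrightarrow>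
      integrable \<nu> f \<and> (t powr \<alpha> - 1) * (\<integral>x. f x \<partial>\<nu>) = t powr \<alpha> * (\<integral>x. f (t * x) \<partial>M) - (\<integral>x. f x \<partial>M)"
  shows "measure M {d<..} \<le> (\<integral>y. star_tail \<alpha> d y \<partial>\<nu>)"
proof -
  interpret M: prob_space M by fact
  interpret N: prob_space \<nu> by fact
  note [measurable_cong] = M(2) \<nu>(2)
  have spM: "space M = UNIV" "space \<nu> = UNIV"
    using M(2) \<nu>(2) by (metis sets_eq_imp_space_eq space_borel)+
  define q where "q = 1 / t powr \<alpha>"
  define N where "N = t powr \<alpha> - 1"
  have tp: "t powr \<alpha> > 1" using t \<alpha> by simp
  have q: "q > 0" "q < 1" using tp by (auto simp: q_def divide_simps)
  have step: "measure M {s<..} = q * (N * measure \<nu> {t * s<..} + measure M {t * s<..})" for s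
  proof -
    let ?f = "indicator {t * s<..} :: real \<Rightarrow> real"
    have ft: "?f (t * x) = indicator {s<..} x" for x
      using t by (auto simp: indicator_def)
    have "integrable M ?f" "integrable M (\<lambda>x. ?f (t * x))"
      by (auto simp: ft intro!: M.integrable_const_bound[where B=1])
    from diff[OF this] have "N * measure \<nu> {t * s<..} = t powr \<alpha> * measure M {s<..} - measure M {t * s<..}"
      by (simp add: ft N_def spM)
    then have "N * measure \<nu> {t * s<..} + measure M {t * s<..} = t powr \<alpha> * measure M {s<..}" by simp
    with tp t show ?thesis unfolding q_def by simp
  qed
  have tel: "measure M {d<..} = (\<Sum>k=1..n. N * q ^ k * measure \<nu> {t ^ k * d<..}) + q ^ n * measure M {t ^ n * d<..}" for n
  proof (induction n)
    case (Suc n)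
    then show ?case using step[of "t ^ n * d"] by (simp add: algebra_simps)
  qed simp
  let ?I = "\<integral>y. star_tail \<alpha> d y \<partial>\<nu>"
  have b: "measure M {d<..} \<le> ?I + q ^ n" for n
  proof -
    have "(\<Sum>k=1..n. N * q ^ k * measure \<nu> {t ^ k * d<..}) = (\<integral>y. (\<Sum>k=1..n. N * q ^ k * indicator {t ^ k * d<..} y) \<partial>\<nu>)"
      by (subst Bochner_Integration.integral_sum)
         (auto simp: spM intro!: integrable_mult_right N.integrable_const_bound[where B=1])
    also have "\<dots> \<le> ?I"
    proof (rule integral_mono)
      show "integrable \<nu> (\<lambda>y. \<Sum>k=1..n. N * q ^ k * indicator {t ^ k * d<..} y)"
        by (intro Bochner_Integration.integrable_sum integrable_mult_right) (auto intro!: N.integrable_const_bound[where B=1])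
      show "integrable \<nu> (star_tail \<alpha> d)"
        by (rule N.integrable_const_bound[where B=1]) (use star_tail_bounds[OF d \<alpha>] in auto)
      show "(\<Sum>k=1..n. N * q ^ k * indicator {t ^ k * d<..} y) \<le> star_tail \<alpha> d y" for y
        unfolding N_def q_def by (rule tail_telescope[OF t \<alpha> d])
    qed
    finally have "(\<Sum>k=1..n. N * q ^ k * measure \<nu> {t ^ k * d<..}) \<le> ?I" .
    moreover have "q ^ n * measure M {t ^ n * d<..} \<le> q ^ n * 1"
      using q by (intro mult_left_mono) auto
    ultimately show ?thesis using tel[of n] by simp
  qed
  have "(\<lambda>n. ?I + q ^ n) \<longlonglongrightarrow> ?I + 0"
    using q by (intro tendsto_intros LIMSEQ_realpow_zero) auto
  then show ?thesis
    using b by (metis LIMSEQ_le_const add.right_neutral)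
qed

lemma powr_quotient_limit:
  fixes \<alpha> \<beta> :: real
  assumes "\<alpha> > 0"
  shows "((\<lambda>t. (t powr \<beta> - 1) / (t powr \<alpha> - 1)) \<longlongrightarrow> \<beta> / \<alpha>) (at_right 1)"
proof -
  have D: "((\<lambda>t. (t powr c - 1) / (t - 1)) \<longlongrightarrow> c) (at_right 1)" for c :: real
  proof -
    have "((\<lambda>t. t powr c) has_real_derivative c) (at 1 within {1<..})"
      by (auto intro!: derivative_eq_intros)
    then show ?thesis by (simp add: has_field_derivative_iff)
  qed
  have "((\<lambda>t. ((t powr \<beta> - 1) / (t - 1)) / ((t powr \<alpha> - 1) / (t - 1))) \<longlongrightarrow> \<beta> / \<alpha>) (at_right 1)"
    using assms by (intro tendsto_divide D) auto
  then show ?thesis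
    by (rule Lim_transform_eventually) (auto simp: eventually_at_filter)
qed

text \<open>
The gap is uniform in \<open>s\<close>. This lets the argument pass to the limit \<open>t \<rightarrow> 1\<close>
although the point \<open>y\<close> supplied by \<open>two_point_reduction\<close> varies with \<open>t\<close>.
\<close>

lemma sqrt_odds_gap:
  fixes \<epsilon> e s :: real
  assumes "0 < \<epsilon>" "\<epsilon> < e" "0 \<le> s" "s \<le> 1 - e"
  shows "sqrt ((1 - e - s) / e) + (e / \<epsilon> - 1) * sqrt \<epsilon> / 2 \<le> sqrt ((1 - \<epsilon> - s) / \<epsilon>)"
proof -
  define A where "A = sqrt ((1 - \<epsilon> - s) / \<epsilon>)"
  define B where "B = sqrt ((1 - e - s) / e)"
  have sq: "A\<^sup>2 = (1 - s) / \<epsilon> - 1" "B\<^sup>2 = (1 - s) / e - 1"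
    using assms by (auto simp: A_def B_def field_simps)
  have "e * (1 / \<epsilon> - 1 / e) \<le> (1 - s) * (1 / \<epsilon> - 1 / e)"
    using assms by (intro mult_right_mono) (auto simp: field_simps)
  then have d: "e / \<epsilon> - 1 \<le> A\<^sup>2 - B\<^sup>2"
    using assms unfolding sq by (simp add: algebra_simps)
  moreover have "e / \<epsilon> - 1 > 0" using assms by simp
  ultimately have "B\<^sup>2 \<le> A\<^sup>2" by simp
  moreover have B0: "B \<ge> 0" "A \<ge> 0" using assms by (auto simp: B_def A_def)
  ultimately have BA: "B \<le> A" using power2_le_imp_le by blast
  have "A \<le> 1 / sqrt \<epsilon>"
  proof -
    have "A \<le> sqrt (1 / \<epsilon>)" unfolding A_def using assms by (intro real_sqrt_le_mono divide_right_mono) auto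
    then show ?thesis by (simp add: real_sqrt_divide)
  qed
  then have "(A - B) * (A + B) \<le> (A - B) * (2 / sqrt \<epsilon>)"
    using BA by (intro mult_left_mono) auto
  also have "(A - B) * (A + B) = A\<^sup>2 - B\<^sup>2" by (simp add: power2_eq_square algebra_simps)
  finally have "e / \<epsilon> - 1 \<le> (A - B) * (2 / sqrt \<epsilon>)" using d by simp
  then have "(e / \<epsilon> - 1) * sqrt \<epsilon> \<le> (A - B) * 2"
    using assms by (simp add: field_simps)
  then have "(e / \<epsilon> - 1) * sqrt \<epsilon> / 2 \<le> A - B" by simp
  then show ?thesis unfolding A_def B_def by linarith
qed

text \<open>
If the tail \<open>e\<close> exceeded \<open>\<epsilon>\<close>, every difference quotient law would yield a point \<open>y\<close> bounded below
by the hypothesis at level \<open>\<epsilon>\<close> and above by the two-point bound at level \<open>e\<close> with perturbed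
moments. The two bounds are separated by \<open>\<sigma>\<close> times a fixed positive gap, whereas the perturbation
vanishes as \<open>t \<rightarrow> 1\<close>.
\<close>

lemma unimodal_tail_bound:
  fixes M :: "real measure"
  assumes M: "prob_space M" "sets M = sets borel" and \<alpha>: "\<alpha> > 0"
    and uni: "\<And>t B. t > 1 \<Longrightarrow> B \<in> sets borel \<Longrightarrow> measure M B \<le> t powr \<alpha> * measure M {x. t * x \<in> B}"
    and i1: "integrable M (\<lambda>x. x)" and m1: "(\<integral>x. x \<partial>M) = \<alpha> / (\<alpha> + 1) * \<rho>"
    and i2: "integrable M (\<lambda>x. x\<^sup>2)" and m2: "(\<integral>x. x\<^sup>2 \<partial>M) = \<alpha> / (\<alpha> + 2) * (\<rho>\<^sup>2 + \<sigma>\<^sup>2)"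
    and \<sigma>: "\<sigma> > 0" and d: "d \<ge> 0" and \<epsilon>: "0 < \<epsilon>"
    and cond: "\<And>y. d < y \<Longrightarrow> (d / y) powr \<alpha> \<le> 1 - \<epsilon> \<Longrightarrow> \<rho> + \<sigma> * sqrt ((1 - \<epsilon> - (d / y) powr \<alpha>) / \<epsilon>) \<le> y"
  shows "measure M {d<..} \<le> \<epsilon>"
proof (rule ccontr)
  assume "\<not> measure M {d<..} \<le> \<epsilon>"
  define e where "e = measure M {d<..}"
  have e: "e > \<epsilon>" using \<open>\<not> _\<close> by (simp add: e_def)
  have e0: "e > 0" using e \<epsilon> by simp
  define r where "r t = (t powr (\<alpha> + 1) - 1) / (t powr \<alpha> - 1) * (\<alpha> / (\<alpha> + 1) * \<rho>)" for t
  define w where "w t = (t powr (\<alpha> + 2) - 1) / (t powr \<alpha> - 1) * (\<alpha> / (\<alpha> + 2) * (\<rho>\<^sup>2 + \<sigma>\<^sup>2)) - (r t)\<^sup>2" for t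
  have "(r \<longlongrightarrow> (\<alpha> + 1) / \<alpha> * (\<alpha> / (\<alpha> + 1) * \<rho>)) (at_right 1)"
    unfolding r_def using \<alpha> by (intro tendsto_intros powr_quotient_limit)
  then have r: "(r \<longlongrightarrow> \<rho>) (at_right 1)" using \<alpha> by simp
  have "(w \<longlongrightarrow> (\<alpha> + 2) / \<alpha> * (\<alpha> / (\<alpha> + 2) * (\<rho>\<^sup>2 + \<sigma>\<^sup>2)) - \<rho>\<^sup>2) (at_right 1)"
    unfolding w_def using \<alpha> by (intro tendsto_intros powr_quotient_limit r)
  then have w: "(w \<longlongrightarrow> \<sigma>\<^sup>2) (at_right 1)" using \<alpha> by simp
  define \<delta> where "\<delta> = (e / \<epsilon> - 1) * sqrt \<epsilon> / 2"
  have \<delta>: "\<delta> > 0" using e \<epsilon> by (simp add: \<delta>_def)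
  have "((\<lambda>t. \<bar>r t - \<rho>\<bar> + \<bar>sqrt (w t) - \<sigma>\<bar> * sqrt (1 / e)) \<longlongrightarrow> \<bar>\<rho> - \<rho>\<bar> + \<bar>sqrt (\<sigma>\<^sup>2) - \<sigma>\<bar> * sqrt (1 / e)) (at_right 1)"
    by (intro tendsto_intros r w)
  then have "\<forall>\<^sub>F t in at_right 1. \<bar>r t - \<rho>\<bar> + \<bar>sqrt (w t) - \<sigma>\<bar> * sqrt (1 / e) < \<sigma> * \<delta>"
    using \<sigma> \<delta> by (intro order_tendstoD(2)) auto
  moreover have "\<forall>\<^sub>F t in at_right 1. w t > 0"
    using \<sigma> by (intro order_tendstoD(1)[OF w]) auto
  moreover have "\<forall>\<^sub>F t in at_right 1. t > (1::real)"
    by (simp add: eventually_at_filter)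
  ultimately have "\<forall>\<^sub>F t in at_right 1. t > (1::real) \<and> w t > 0 \<and> \<bar>r t - \<rho>\<bar> + \<bar>sqrt (w t) - \<sigma>\<bar> * sqrt (1 / e) < \<sigma> * \<delta>"
    by eventually_elim auto
  then obtain t where t: "t > 1" and wt: "w t > 0"
    and small: "\<bar>r t - \<rho>\<bar> + \<bar>sqrt (w t) - \<sigma>\<bar> * sqrt (1 / e) < \<sigma> * \<delta>"
    using eventually_happens'[of "at_right (1::real)"] by (metis (no_types, lifting) trivial_limit_at_right_real)
  obtain \<nu> where \<nu>: "prob_space \<nu>" "sets \<nu> = sets borel"
    and diff: "\<And>f :: real \<Rightarrow> real. integrable M f \<Longrightarrow> integrable M (\<lambda>x. f (t * x)) \<Longrightarrow>
      integrable \<nu> f \<and> (t powr \<alpha> - 1) * (\<integral>x. f x \<partial>\<nu>) = t powr \<alpha> * (\<integral>x. f (t * x) \<partial>M) - (\<integral>x. f x \<partial>M)"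
    using difference_quotient_law[OF M t \<alpha>] uni[OF t] by metis
  have N: "t powr \<alpha> - 1 > 0" using t \<alpha> by simp
  have "integrable M (\<lambda>x. t * x)" using i1 by auto
  then have n1: "integrable \<nu> (\<lambda>y. y)" "(\<integral>y. y \<partial>\<nu>) = r t"
  proof -
    have "(t powr \<alpha> - 1) * (\<integral>y. y \<partial>\<nu>) = (t powr (\<alpha> + 1) - 1) * (\<integral>x. x \<partial>M)"
      using diff[OF i1 \<open>integrable M (\<lambda>x. t * x)\<close>] t by (simp add: powr_add algebra_simps)
    then have "(\<integral>y. y \<partial>\<nu>) = (t powr (\<alpha> + 1) - 1) * (\<integral>x. x \<partial>M) / (t powr \<alpha> - 1)"
      using N by (simp add: eq_divide_eq mult.commute)
    then show "(\<integral>y. y \<partial>\<nu>) = r t"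
      unfolding r_def m1 by simp
  qed (use diff[OF i1 \<open>integrable M (\<lambda>x. t * x)\<close>] in auto)
  have "integrable M (\<lambda>x. (t * x)\<^sup>2)" using i2 by (auto simp: power_mult_distrib)
  from diff[OF i2 this] have n2: "integrable \<nu> (\<lambda>y. y\<^sup>2)"
    and "(t powr \<alpha> - 1) * (\<integral>y. y\<^sup>2 \<partial>\<nu>) = (t powr \<alpha> * t\<^sup>2 - 1) * (\<integral>x. x\<^sup>2 \<partial>M)"
    by (auto simp: power_mult_distrib algebra_simps)
  moreover have "t powr (\<alpha> + 2) = t powr \<alpha> * t\<^sup>2" using t by (simp add: powr_add)
  ultimately have "(\<integral>y. y\<^sup>2 \<partial>\<nu>) = (t powr (\<alpha> + 2) - 1) * (\<integral>x. x\<^sup>2 \<partial>M) / (t powr \<alpha> - 1)"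
    using N by (simp add: eq_divide_eq mult.commute)
  then have "(\<integral>y. y\<^sup>2 \<partial>\<nu>) = (r t)\<^sup>2 + w t"
    unfolding w_def m2 by simp
  then have n3: "(\<integral>y. y\<^sup>2 \<partial>\<nu>) = (r t)\<^sup>2 + (sqrt (w t))\<^sup>2" using wt by simp
  have "e \<le> (\<integral>y. star_tail \<alpha> d y \<partial>\<nu>)"
    unfolding e_def using tail_le_star_tail[OF M \<nu> t \<alpha> d diff] by blast
  then obtain y where y: "d < y" "(d / y) powr \<alpha> \<le> 1 - e"
    "y \<le> r t + sqrt (w t) * sqrt ((1 - e - (d / y) powr \<alpha>) / e)"
    using two_point_reduction[OF \<nu> n1 n2 n3 _ d \<alpha> e0] wt by (metis real_sqrt_gt_0_iff)
  define s where "s = (d / y) powr \<alpha>"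
  have s: "0 \<le> s" "s \<le> 1 - e" using y by (auto simp: s_def)
  have "\<rho> + \<sigma> * sqrt ((1 - \<epsilon> - s) / \<epsilon>) \<le> y"
    unfolding s_def using y e by (intro cond) auto
  moreover have "\<sigma> * (sqrt ((1 - e - s) / e) + \<delta>) \<le> \<sigma> * sqrt ((1 - \<epsilon> - s) / \<epsilon>)"
    using sqrt_odds_gap[OF \<epsilon> e s] \<sigma> by (simp add: \<delta>_def)
  ultimately have "\<sigma> * \<delta> \<le> (r t - \<rho>) + (sqrt (w t) - \<sigma>) * sqrt ((1 - e - s) / e)"
    using y(3) unfolding s_def[symmetric] by (simp add: algebra_simps)
  also have "\<dots> \<le> \<bar>r t - \<rho>\<bar> + \<bar>sqrt (w t) - \<sigma>\<bar> * sqrt (1 / e)"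
  proof -
    have "(sqrt (w t) - \<sigma>) * sqrt ((1 - e - s) / e) \<le> \<bar>sqrt (w t) - \<sigma>\<bar> * sqrt ((1 - e - s) / e)"
      using s e0 by (intro mult_right_mono) auto
    also have "\<dots> \<le> \<bar>sqrt (w t) - \<sigma>\<bar> * sqrt (1 / e)"
      using s e0 by (intro mult_left_mono real_sqrt_le_mono divide_right_mono) auto
    finally show ?thesis by simp
  qed
  finally show False using small by simp
qed

section \<open>Radial mixtures\<close>

abbreviation unit_uniform :: "real measure" where
  "unit_uniform \<equiv> uniform_measure lborel {0..1}"

lemma unit_uniform_density: "unit_uniform = density lborel (\<lambda>u. ennreal (indicator {0..1} u))"
  by (simp add: uniform_measure_def divide_ennreal_def flip: ennreal_indicator)

lemma prob_space_unit_uniform: "prob_space unit_uniform"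
  by (rule prob_space_uniform_measure) auto

lemma AE_unit_uniform: "AE u in unit_uniform. 0 \<le> u \<and> u \<le> 1"
  by (rule AE_uniform_measureI) auto

lemma unit_uniform_powr:
  assumes "c \<ge> 0"
  shows "integrable unit_uniform (\<lambda>u. u powr c)" "(\<integral>u. u powr c \<partial>unit_uniform) = 1 / (c + 1)"
proof -
  interpret prob_space unit_uniform by (rule prob_space_unit_uniform)
  show "integrable unit_uniform (\<lambda>u. u powr c)"
  proof (rule integrable_const_bound[where B=1])
    show "AE u in unit_uniform. norm (u powr c) \<le> 1"
      using AE_unit_uniform by eventually_elim (use assms in \<open>auto intro: powr_le1\<close>)
  qed simp
  then have "integrable lborel (\<lambda>u. indicator {0..1} u *\<^sub>R (u powr c))"
    unfolding unit_uniform_density by (subst (asm) integrable_density) auto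
  then have si: "set_integrable lborel {0..1} (\<lambda>u. u powr c)"
    by (simp add: set_integrable_def)
  have "(\<integral>u. u powr c \<partial>unit_uniform) = (\<integral>u. indicator {0..1} u *\<^sub>R (u powr c) \<partial>lborel)"
    unfolding unit_uniform_density by (subst integral_density) auto
  also have "\<dots> = integral {0..1} (\<lambda>u. u powr c)"
    using set_borel_integral_eq_integral(2)[OF si] by (simp add: set_lebesgue_integral_def)
  also have "\<dots> = 1 / (c + 1)"
    using has_integral_powr_from_0[of c 1] assms by (simp add: integral_unique)
  finally show "(\<integral>u. u powr c \<partial>unit_uniform) = 1 / (c + 1)" .
qed

text \<open>
The law of \<open>m + U\<^bsup>1/\<alpha>\<^esup> z(j)\<close>, with \<open>j\<close> drawn from \<open>Q\<close> independently of the uniform variable \<open>U\<close>.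
\<close>

definition star_law :: "real \<Rightarrow> real^'n \<Rightarrow> ('j \<Rightarrow> real^'n) \<Rightarrow> 'j pmf \<Rightarrow> (real^'n) measure" where
  "star_law \<alpha> m z Q = distr (unit_uniform \<Otimes>\<^sub>M measure_pmf Q) borel (\<lambda>(u, j). m + (u powr (1 / \<alpha>)) *\<^sub>R z j)"

lemma measurable_snd_pmf [measurable]:
  "(\<lambda>w. z (snd w) :: real^'n) \<in> borel_measurable (M \<Otimes>\<^sub>M count_space UNIV)"
  by (rule measurable_compose[OF measurable_snd]) simp

lemma measurable_star [measurable]:
  "(\<lambda>(u, j). m + (u powr (1 / \<alpha>)) *\<^sub>R (z j :: real^'n)) \<in> borel_measurable (unit_uniform \<Otimes>\<^sub>M measure_pmf Q)"
  by measurable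

lemma prob_space_star_product: "prob_space (unit_uniform \<Otimes>\<^sub>M measure_pmf Q)"
  by (intro prob_space_pair prob_space_unit_uniform prob_space_measure_pmf)

lemma prob_space_star_law: "prob_space (star_law \<alpha> m z Q)"
  unfolding star_law_def by (rule prob_space.prob_space_distr[OF prob_space_star_product measurable_star])

lemma sets_star_law [simp, measurable_cong]: "sets (star_law \<alpha> m z Q) = sets borel"
  by (simp add: star_law_def)

text \<open>
Substituting \<open>v = t\<^bsup>\<alpha>\<^esup> u\<close> moves the dependence on \<open>t\<close> from the integrand to the domain of integration,
where monotonicity in \<open>t\<close> is evident. This is why radial mixtures are \<open>\<alpha>\<close>-unimodal.
\<close>

lemma scaled_uniform_ray:
  fixes z :: "real^'n"
  assumes \<alpha>: "\<alpha> > 0" and t: "t > 0" and B: "B \<in> sets borel"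
  shows "ennreal (t powr \<alpha>) * emeasure unit_uniform {u. (t * u powr (1 / \<alpha>)) *\<^sub>R z \<in> B}
     = emeasure lborel ({v. (v powr (1 / \<alpha>)) *\<^sub>R z \<in> B} \<inter> {0..t powr \<alpha>})"
proof -
  let ?S = "{v. (v powr (1 / \<alpha>)) *\<^sub>R z \<in> B} \<inter> {0..t powr \<alpha>}"
  let ?T = "{0..1} \<inter> {u. (t * u powr (1 / \<alpha>)) *\<^sub>R z \<in> B}"
  have [measurable]: "B \<in> sets borel" by fact
  have tp: "t powr \<alpha> > 0" using t by simp
  have ind: "indicator ?S (0 + t powr \<alpha> * u) = (indicator ?T u :: ennreal)" for u
  proof -
    have "(t powr \<alpha> * u) powr (1 / \<alpha>) = t * u powr (1 / \<alpha>)" if "u \<ge> 0"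
      using that t \<alpha> by (simp add: powr_mult powr_powr)
    moreover have "t powr \<alpha> * u \<le> t powr \<alpha> \<longleftrightarrow> u \<le> 1" "0 \<le> t powr \<alpha> * u \<longleftrightarrow> 0 \<le> u"
      using tp by (auto simp: zero_le_mult_iff)
    ultimately show ?thesis by (auto simp: indicator_def)
  qed
  have "emeasure lborel ?S = (\<integral>\<^sup>+v. indicator ?S v \<partial>lborel)" by simp
  also have "\<dots> = ennreal \<bar>t powr \<alpha>\<bar> * (\<integral>\<^sup>+u. indicator ?S (0 + t powr \<alpha> * u) \<partial>lborel)"
    using tp by (intro nn_integral_real_affine) auto
  also have "\<dots> = ennreal (t powr \<alpha>) * emeasure lborel ?T"
    unfolding ind using tp by simp
  finally show ?thesis by (simp add: divide_ennreal_def)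
qed

lemma alpha_unimodal_star_law:
  fixes z :: "'j \<Rightarrow> real^'n"
  assumes \<alpha>: "\<alpha> > 0"
  shows "alpha_unimodal \<alpha> m (star_law \<alpha> m z Q)"
  unfolding alpha_unimodal_def alpha_unimodal0_def
proof (intro ballI mono_onI)
  fix B :: "(real^'n) set" and r s :: real
  assume B[measurable]: "B \<in> sets borel" and rs: "r \<in> {0<..}" "s \<in> {0<..}" "r \<le> s"
  let ?P = "distr (star_law \<alpha> m z Q) borel (\<lambda>\<xi>. \<xi> - m)"
  let ?\<Omega> = "unit_uniform \<Otimes>\<^sub>M measure_pmf Q"
  interpret \<Omega>: prob_space ?\<Omega> by (rule prob_space_star_product)
  interpret U: prob_space unit_uniform by (rule prob_space_unit_uniform)
  interpret UQ: pair_sigma_finite unit_uniform "measure_pmf Q" ..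
  interpret P: prob_space ?P by (rule prob_space.prob_space_distr[OF prob_space_star_law]) simp
  have em: "ennreal (t powr \<alpha>) * emeasure ?P ((\<lambda>z. z /\<^sub>R t) ` B)
      = (\<integral>\<^sup>+j. emeasure lborel ({v. (v powr (1 / \<alpha>)) *\<^sub>R z j \<in> B} \<inter> {0..t powr \<alpha>}) \<partial>measure_pmf Q)"
    if t: "t > 0" for t
  proof -
    have im: "(\<lambda>z. z /\<^sub>R t) ` B = (\<lambda>z. t *\<^sub>R z) -` B"
      using t by (auto simp: image_iff intro!: bexI[where x="t *\<^sub>R _"])
    have [measurable]: "(\<lambda>z. t *\<^sub>R z) -` B \<in> sets borel"
      using measurable_sets[of "\<lambda>z. t *\<^sub>R z" borel borel B] by simp
    let ?A = "{w \<in> space ?\<Omega>. (t * fst w powr (1 / \<alpha>)) *\<^sub>R z (snd w) \<in> B}"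
    have A: "?A \<in> sets ?\<Omega>" by measurable
    have "?P = distr ?\<Omega> borel (\<lambda>w. (fst w powr (1 / \<alpha>)) *\<^sub>R z (snd w))"
      unfolding star_law_def by (subst distr_distr) (auto simp: comp_def case_prod_beta)
    then have "emeasure ?P ((\<lambda>z. z /\<^sub>R t) ` B) = emeasure ?\<Omega> ?A"
      unfolding im by (simp add: emeasure_distr vimage_def Int_def conj_commute)
    also have "\<dots> = (\<integral>\<^sup>+j. emeasure unit_uniform ((\<lambda>u. (u, j)) -` ?A) \<partial>measure_pmf Q)"
      by (rule UQ.emeasure_pair_measure_alt2[OF A])
    also have "\<dots> = (\<integral>\<^sup>+j. emeasure unit_uniform {u. (t * u powr (1 / \<alpha>)) *\<^sub>R z j \<in> B} \<partial>measure_pmf Q)"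
      by (simp add: vimage_def space_pair_measure)
    finally show ?thesis
      using scaled_uniform_ray[OF \<alpha> t B] by (simp flip: nn_integral_cmult)
  qed
  have "ennreal (r powr \<alpha>) * emeasure ?P ((\<lambda>z. z /\<^sub>R r) ` B) \<le> ennreal (s powr \<alpha>) * emeasure ?P ((\<lambda>z. z /\<^sub>R s) ` B)"
  proof -
    have "r powr \<alpha> \<le> s powr \<alpha>" using rs \<alpha> by (intro powr_mono2) auto
    then have "emeasure lborel ({v. (v powr (1 / \<alpha>)) *\<^sub>R z j \<in> B} \<inter> {0..r powr \<alpha>})
      \<le> emeasure lborel ({v. (v powr (1 / \<alpha>)) *\<^sub>R z j \<in> B} \<inter> {0..s powr \<alpha>})" for j
      by (intro emeasure_mono) auto
    then show ?thesis using rs by (simp add: em nn_integral_mono)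
  qed
  then show "r powr \<alpha> * measure ?P ((\<lambda>z. z /\<^sub>R r) ` B) \<le> s powr \<alpha> * measure ?P ((\<lambda>z. z /\<^sub>R s) ` B)"
    by (simp add: P.emeasure_eq_measure flip: ennreal_mult)
qed

lemma star_law_bounded:
  fixes z :: "'j::finite \<Rightarrow> real^'n"
  assumes \<alpha>: "\<alpha> > 0"
  obtains K where "AE \<xi> in star_law \<alpha> m z Q. norm \<xi> \<le> K"
proof -
  interpret U: prob_space unit_uniform by (rule prob_space_unit_uniform)
  interpret UQ: pair_sigma_finite unit_uniform "measure_pmf Q" ..
  define K where "K = norm m + (\<Sum>j\<in>UNIV. norm (z j))"
  have b: "norm (m + (u powr (1 / \<alpha>)) *\<^sub>R z j) \<le> K" if "0 \<le> u \<and> u \<le> 1" for u j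
  proof -
    have "u powr (1 / \<alpha>) \<le> 1" using that \<alpha> by (intro powr_le1) auto
    then have "u powr (1 / \<alpha>) * norm (z j) \<le> 1 * norm (z j)" by (intro mult_right_mono) auto
    moreover have "norm (z j) \<le> (\<Sum>j\<in>UNIV. norm (z j))" by (rule member_le_sum) auto
    ultimately show ?thesis
      using norm_triangle_ineq[of m "(u powr (1 / \<alpha>)) *\<^sub>R z j"] by (simp add: K_def)
  qed
  have "AE w in unit_uniform \<Otimes>\<^sub>M measure_pmf Q. norm (case w of (u, j) \<Rightarrow> m + (u powr (1 / \<alpha>)) *\<^sub>R z j) \<le> K"
  proof (rule UQ.AE_pair_measure)
    show "AE u in unit_uniform. AE j in measure_pmf Q. norm (case (u, j) of (u, j) \<Rightarrow> m + (u powr (1 / \<alpha>)) *\<^sub>R z j) \<le> K"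
      using AE_unit_uniform by eventually_elim (use b in auto)
  qed measurable
  then have "AE \<xi> in star_law \<alpha> m z Q. norm \<xi> \<le> K"
    unfolding star_law_def by (subst AE_distr_iff) auto
  then show thesis by (rule that)
qed

lemma star_law_integral:
  fixes z :: "'j \<Rightarrow> real^'n" and f :: "real^'n \<Rightarrow> real"
  assumes f: "integrable (star_law \<alpha> m z Q) f"
  shows "(\<integral>\<xi>. f \<xi> \<partial>star_law \<alpha> m z Q)
    = (\<integral>u. (\<integral>j. f (m + (u powr (1 / \<alpha>)) *\<^sub>R z j) \<partial>measure_pmf Q) \<partial>unit_uniform)"
proof -
  interpret U: prob_space unit_uniform by (rule prob_space_unit_uniform)
  interpret UQ: pair_sigma_finite unit_uniform "measure_pmf Q" ..
  have fm: "f \<in> borel_measurable borel"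
    using f by (metis borel_measurable_integrable measurable_cong_sets sets_star_law)
  have i: "integrable (unit_uniform \<Otimes>\<^sub>M measure_pmf Q) (\<lambda>(u, j). f (m + (u powr (1 / \<alpha>)) *\<^sub>R z j))"
    using f fm unfolding star_law_def by (subst (asm) integrable_distr_eq) (auto simp: case_prod_beta')
  have "(\<integral>\<xi>. f \<xi> \<partial>star_law \<alpha> m z Q) = (\<integral>(u, j). f (m + (u powr (1 / \<alpha>)) *\<^sub>R z j) \<partial>(unit_uniform \<Otimes>\<^sub>M measure_pmf Q))"
    using fm unfolding star_law_def by (subst integral_distr) (auto simp: case_prod_beta')
  also have "\<dots> = (\<integral>u. (\<integral>j. f (m + (u powr (1 / \<alpha>)) *\<^sub>R z j) \<partial>measure_pmf Q) \<partial>unit_uniform)"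
    using UQ.integral_fst[OF i] by simp
  finally show ?thesis .
qed

lemma star_law_moments:
  fixes z :: "'j::finite \<Rightarrow> real^'n"
  assumes \<alpha>: "\<alpha> > 0"
  shows "integrable (star_law \<alpha> m z Q) (\<lambda>\<xi>. \<xi>)"
    and "integrable (star_law \<alpha> m z Q) (\<lambda>\<xi>. outer \<xi> \<xi>)"
    and "(\<integral>\<xi>. v \<bullet> \<xi> \<partial>star_law \<alpha> m z Q) = v \<bullet> m + \<alpha> / (\<alpha> + 1) * (\<integral>j. v \<bullet> z j \<partial>measure_pmf Q)"
    and "(\<integral>\<xi>. (v \<bullet> \<xi>)\<^sup>2 \<partial>star_law \<alpha> m z Q) = (v \<bullet> m)\<^sup>2
      + 2 * (v \<bullet> m) * (\<alpha> / (\<alpha> + 1)) * (\<integral>j. v \<bullet> z j \<partial>measure_pmf Q)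
      + \<alpha> / (\<alpha> + 2) * (\<integral>j. (v \<bullet> z j)\<^sup>2 \<partial>measure_pmf Q)"
proof -
  interpret U: prob_space unit_uniform by (rule prob_space_unit_uniform)
  interpret P: prob_space "star_law \<alpha> m z Q" by (rule prob_space_star_law)
  obtain K where K: "AE \<xi> in star_law \<alpha> m z Q. norm \<xi> \<le> K"
    using star_law_bounded[OF \<alpha>] by blast
  show 1: "integrable (star_law \<alpha> m z Q) (\<lambda>\<xi>. \<xi>)"
    by (rule P.integrable_const_bound[OF K]) simp
  have mo: "(\<lambda>\<xi>. outer \<xi> \<xi>) \<in> borel_measurable (borel :: (real^'n) measure)"
    unfolding outer_def by (intro borel_measurable_continuous_onI continuous_intros)
  have no: "norm (outer \<xi> \<xi>) \<le> (\<Sum>i\<in>(UNIV::'n set). \<Sum>j\<in>(UNIV::'n set). (norm \<xi>)\<^sup>2)" for \<xi> :: "real^'n"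
  proof -
    have "norm (outer \<xi> \<xi>) \<le> (\<Sum>i\<in>UNIV. norm (outer \<xi> \<xi> $ i))"
      unfolding norm_vec_def by (rule L2_set_le_sum) simp
    also have "\<dots> \<le> (\<Sum>i\<in>UNIV. \<Sum>j\<in>UNIV. norm (outer \<xi> \<xi> $ i $ j))"
      by (intro sum_mono) (subst norm_vec_def, rule L2_set_le_sum, simp)
    also have "\<dots> \<le> (\<Sum>i\<in>(UNIV::'n set). \<Sum>j\<in>(UNIV::'n set). (norm \<xi>)\<^sup>2)"
      by (intro sum_mono)
         (simp add: outer_def abs_mult power2_eq_square component_le_norm_cart mult_mono)
    finally show ?thesis .
  qed
  show 2: "integrable (star_law \<alpha> m z Q) (\<lambda>\<xi>. outer \<xi> \<xi>)"
  proof (rule P.integrable_const_bound)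
    show "AE \<xi> in star_law \<alpha> m z Q. norm (outer \<xi> \<xi>) \<le> (\<Sum>i\<in>(UNIV::'n set). \<Sum>j\<in>(UNIV::'n set). K\<^sup>2)"
      using K
    proof eventually_elim
      case (elim \<xi>)
      then have "(norm \<xi>)\<^sup>2 \<le> K\<^sup>2" by (intro power_mono) auto
      then have "(\<Sum>i\<in>(UNIV::'n set). \<Sum>j\<in>(UNIV::'n set). (norm \<xi>)\<^sup>2) \<le> (\<Sum>i\<in>(UNIV::'n set). \<Sum>j\<in>(UNIV::'n set). K\<^sup>2)"
        by (intro sum_mono)
      with no[of \<xi>] show ?case by linarith
    qed
  qed (use mo in simp)
  have fin: "integrable (measure_pmf Q) g" for g :: "'j \<Rightarrow> real"
    by (rule integrable_measure_pmf_finite) simp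
  have i1: "integrable (star_law \<alpha> m z Q) (\<lambda>\<xi>. v \<bullet> \<xi>)" using 1 by auto
  have i2: "integrable (star_law \<alpha> m z Q) (\<lambda>\<xi>. (v \<bullet> \<xi>)\<^sup>2)"
  proof (rule P.integrable_const_bound)
    show "AE \<xi> in star_law \<alpha> m z Q. norm ((v \<bullet> \<xi>)\<^sup>2) \<le> (norm v * K)\<^sup>2"
      using K
    proof eventually_elim
      case (elim \<xi>)
      have "\<bar>v \<bullet> \<xi>\<bar> \<le> norm v * norm \<xi>" by (rule Cauchy_Schwarz_ineq2)
      also have "\<dots> \<le> norm v * K" using elim by (intro mult_left_mono) auto
      finally have "\<bar>v \<bullet> \<xi>\<bar>\<^sup>2 \<le> (norm v * K)\<^sup>2" by (intro power_mono) auto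
      then show ?case by simp
    qed
  qed simp
  define E1 where "E1 = (\<integral>j. v \<bullet> z j \<partial>measure_pmf Q)"
  define E2 where "E2 = (\<integral>j. (v \<bullet> z j)\<^sup>2 \<partial>measure_pmf Q)"
  have p1: "integrable unit_uniform (\<lambda>u. u powr (1 / \<alpha>))"
    "(\<integral>u. u powr (1 / \<alpha>) \<partial>unit_uniform) = \<alpha> / (\<alpha> + 1)"
    using unit_uniform_powr[of "1 / \<alpha>"] \<alpha> by (auto simp: field_simps)
  have p2: "integrable unit_uniform (\<lambda>u. u powr (2 / \<alpha>))"
    "(\<integral>u. u powr (2 / \<alpha>) \<partial>unit_uniform) = \<alpha> / (\<alpha> + 2)"
    using unit_uniform_powr[of "2 / \<alpha>"] \<alpha> by (auto simp: field_simps)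
  have one: "measure unit_uniform UNIV = 1" using U.prob_space by simp
  have "(\<integral>\<xi>. v \<bullet> \<xi> \<partial>star_law \<alpha> m z Q) = (\<integral>u. v \<bullet> m + u powr (1 / \<alpha>) * E1 \<partial>unit_uniform)"
    unfolding star_law_integral[OF i1] using fin by (simp add: inner_add_right E1_def)
  also have "\<dots> = v \<bullet> m + \<alpha> / (\<alpha> + 1) * E1"
    using p1 one by simp
  finally show "(\<integral>\<xi>. v \<bullet> \<xi> \<partial>star_law \<alpha> m z Q) = v \<bullet> m + \<alpha> / (\<alpha> + 1) * (\<integral>j. v \<bullet> z j \<partial>measure_pmf Q)"
    by (simp add: E1_def)
  have ex: "(v \<bullet> (m + (u powr (1 / \<alpha>)) *\<^sub>R z j))\<^sup>2
     = (v \<bullet> m)\<^sup>2 + 2 * (v \<bullet> m) * u powr (1 / \<alpha>) * (v \<bullet> z j) + u powr (2 / \<alpha>) * (v \<bullet> z j)\<^sup>2" for u j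
  proof -
    have "u powr (2 / \<alpha>) = u powr (1 / \<alpha>) * u powr (1 / \<alpha>)" by (simp flip: powr_add)
    then show ?thesis by (simp add: inner_add_right power2_eq_square algebra_simps)
  qed
  have "(\<integral>\<xi>. (v \<bullet> \<xi>)\<^sup>2 \<partial>star_law \<alpha> m z Q)
      = (\<integral>u. (v \<bullet> m)\<^sup>2 + 2 * (v \<bullet> m) * u powr (1 / \<alpha>) * E1 + u powr (2 / \<alpha>) * E2 \<partial>unit_uniform)"
    unfolding star_law_integral[OF i2] ex using fin by (simp add: E1_def E2_def)
  also have "\<dots> = (v \<bullet> m)\<^sup>2 + 2 * (v \<bullet> m) * (\<alpha> / (\<alpha> + 1)) * E1 + \<alpha> / (\<alpha> + 2) * E2"
    using p1 p2 one by simp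
  finally show "(\<integral>\<xi>. (v \<bullet> \<xi>)\<^sup>2 \<partial>star_law \<alpha> m z Q) = (v \<bullet> m)\<^sup>2
      + 2 * (v \<bullet> m) * (\<alpha> / (\<alpha> + 1)) * (\<integral>j. v \<bullet> z j \<partial>measure_pmf Q)
      + \<alpha> / (\<alpha> + 2) * (\<integral>j. (v \<bullet> z j)\<^sup>2 \<partial>measure_pmf Q)"
    by (simp add: E1_def E2_def)
qed

text \<open>
A mixing point with \<open>a \<bullet> z = c\<close> contributes the probability that \<open>U\<^bsup>1/\<alpha>\<^esup> c > d\<close>.
\<close>

lemma star_law_tail:
  fixes z :: "'j \<Rightarrow> real^'n"
  assumes \<alpha>: "\<alpha> > 0" and d: "0 \<le> d" "d < c" and J: "\<And>j. j \<in> J \<Longrightarrow> a \<bullet> z j = c"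
  shows "measure (measure_pmf Q) J * (1 - (d / c) powr \<alpha>) \<le> measure (star_law \<alpha> m z Q) {\<xi>. a \<bullet> m + d < a \<bullet> \<xi>}"
proof -
  let ?\<Omega> = "unit_uniform \<Otimes>\<^sub>M measure_pmf Q"
  interpret \<Omega>: prob_space ?\<Omega> by (rule prob_space_star_product)
  interpret U: prob_space unit_uniform by (rule prob_space_unit_uniform)
  interpret UQ: pair_sigma_finite unit_uniform "measure_pmf Q" ..
  interpret P: prob_space "star_law \<alpha> m z Q" by (rule prob_space_star_law)
  define s where "s = (d / c) powr \<alpha>"
  have s: "0 \<le> s" "s \<le> 1" using d \<alpha> by (auto simp: s_def intro!: powr_le1)
  have big: "d < u powr (1 / \<alpha>) * c" if "s < u" for u
  proof -
    have "s powr (1 / \<alpha>) < u powr (1 / \<alpha>)" using that s \<alpha> by (intro powr_less_mono2) auto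
    moreover have "s powr (1 / \<alpha>) = d / c" using d \<alpha> by (simp add: s_def powr_powr)
    ultimately show ?thesis using d by (simp add: field_simps)
  qed
  let ?A = "{w \<in> space ?\<Omega>. (case w of (u, j) \<Rightarrow> m + (u powr (1 / \<alpha>)) *\<^sub>R z j) \<in> {\<xi>. a \<bullet> m + d < a \<bullet> \<xi>}}"
  have H: "{\<xi>. a \<bullet> m + d < a \<bullet> \<xi>} \<in> sets borel" by measurable
  have A: "?A \<in> sets ?\<Omega>" using H by measurable
  have "emeasure unit_uniform {s<..1} * emeasure (measure_pmf Q) J = emeasure ?\<Omega> ({s<..1} \<times> J)"
    by (rule measure_pmf.emeasure_pair_measure_Times[symmetric]) auto
  also have "\<dots> \<le> emeasure ?\<Omega> ?A"
    using big J by (intro emeasure_mono A) (auto simp: space_pair_measure inner_add_right)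
  also have "\<dots> = emeasure (star_law \<alpha> m z Q) {\<xi>. a \<bullet> m + d < a \<bullet> \<xi>}"
    unfolding star_law_def using H by (subst emeasure_distr) (auto simp: vimage_def Int_def conj_commute)
  also have "emeasure unit_uniform {s<..1} = ennreal (1 - s)"
  proof -
    have "{0..1} \<inter> {s<..1} = {s<..1}" using s by auto
    then show ?thesis using s by (simp add: divide_ennreal_def)
  qed
  finally show ?thesis
    using s by (simp add: P.emeasure_eq_measure measure_pmf.emeasure_eq_measure s_def mult.commute flip: ennreal_mult)
qed

section \<open>The extremal mixing law\<close>

lemma expectation_bernoulli_axes:
  fixes f :: "bool \<times> ('n::finite \<times> bool) \<Rightarrow> real"
  assumes "0 \<le> p" "p \<le> 1"
  shows "(\<integral>j. f j \<partial>measure_pmf (pair_pmf (bernoulli_pmf p) (pmf_of_set UNIV)))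
    = (\<Sum>i\<in>UNIV. p * (f (True, i, True) + f (True, i, False)) + (1 - p) * (f (False, i, True) + f (False, i, False)))
      / (2 * real CARD('n))"
proof -
  let ?Q = "pair_pmf (bernoulli_pmf p) (pmf_of_set (UNIV :: ('n \<times> bool) set))"
  have pmf: "pmf ?Q (y, i, s) = (if y then p else 1 - p) / (2 * real CARD('n))" for y i s
    using assms by (cases y) (simp_all add: pmf_pair mult.commute)
  have "(\<integral>j. f j \<partial>measure_pmf ?Q) = (\<Sum>j\<in>UNIV. pmf ?Q j * f j)"
    by (subst integral_measure_pmf[of UNIV]) auto
  also have "\<dots> = (\<Sum>y\<in>UNIV. \<Sum>i\<in>UNIV. \<Sum>s\<in>UNIV. pmf ?Q (y, i, s) * f (y, i, s))"
    by (simp only: UNIV_Times_UNIV[symmetric] sum.cartesian_product case_prod_beta' prod.collapse)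
  also have "\<dots> = (\<Sum>i\<in>UNIV. p * (f (True, i, True) + f (True, i, False)) + (1 - p) * (f (False, i, True) + f (False, i, False)))
      / (2 * real CARD('n))"
    unfolding pmf UNIV_bool by (auto simp: sum_divide_distrib sum.distrib[symmetric] field_simps intro!: sum.cong)
  finally show ?thesis .
qed

text \<open>
Let \<open>w\<close> be the unit vector along \<open>R a\<close>, let \<open>T\<close> be the standardised two-point variable whose upper
value has probability \<open>p\<close>, and let \<open>g\<close> be uniform on the vectors \<open>\<plusminus> sqrt n e\<^sub>i\<close>, so
that it is centred with identity covariance. Then \<open>T w\<close> plus the component of \<open>g\<close> orthogonal to \<open>w\<close>
again has identity covariance, hence \<open>\<zeta> + R (T w + g - (w \<bullet> g) w)\<close> has covariance \<open>R\<^sup>2\<close>, while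
its inner product with \<open>a\<close> is \<open>a \<bullet> \<zeta> + \<parallel>R a\<parallel> T\<close>.
\<close>

lemma worst_case_mixture:
  fixes R :: "real^'n^'n" and a \<zeta> :: "real^'n"
  assumes R: "transpose R = R" and Ra: "R *v a \<noteq> 0" and p: "0 < p" "p < 1"
  obtains z :: "bool \<times> ('n \<times> bool) \<Rightarrow> real^'n" and Q J where
    "\<And>v. (\<integral>j. v \<bullet> z j \<partial>measure_pmf Q) = v \<bullet> \<zeta>"
    "\<And>v. (\<integral>j. (v \<bullet> z j)\<^sup>2 \<partial>measure_pmf Q) = (v \<bullet> \<zeta>)\<^sup>2 + (norm (R *v v))\<^sup>2"
    "\<And>j. j \<in> J \<Longrightarrow> a \<bullet> z j = a \<bullet> \<zeta> + norm (R *v a) * sqrt ((1 - p) / p)"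
    "measure (measure_pmf Q) J = p"
proof -
  define N where "N = real CARD('n)"
  have N: "N > 0" by (simp add: N_def)
  define \<sigma> where "\<sigma> = norm (R *v a)"
  define w where "w = (1 / \<sigma>) *\<^sub>R (R *v a)"
  have \<sigma>: "\<sigma> > 0" using Ra by (simp add: \<sigma>_def)
  have Raw: "R *v a = \<sigma> *\<^sub>R w" using \<sigma> by (simp add: w_def)
  have ww: "w \<bullet> w = 1" using \<sigma> by (simp add: w_def \<sigma>_def flip: power2_norm_eq_inner)
  define T where "T y = (if y then sqrt ((1 - p) / p) else - sqrt (p / (1 - p)))" for y
  define g :: "'n \<Rightarrow> bool \<Rightarrow> real^'n" where "g i s = ((if s then 1 else -1) * sqrt N) *\<^sub>R axis i 1" for i s
  define z where "z = (\<lambda>(y, i, s). \<zeta> + R *v (T y *\<^sub>R w + (g i s - (w \<bullet> g i s) *\<^sub>R w)))"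
  define Q where "Q = pair_pmf (bernoulli_pmf p) (pmf_of_set (UNIV :: ('n \<times> bool) set))"
  have T1: "p * T True + (1 - p) * T False = 0"
  proof -
    have s: "x * sqrt (y / x) = sqrt (x * y)" if "x > 0" for x y :: real
    proof -
      have "sqrt (x * y) = sqrt (x\<^sup>2 * (y / x))" using that by (simp add: power2_eq_square)
      also have "\<dots> = x * sqrt (y / x)" using that unfolding real_sqrt_mult by simp
      finally show ?thesis by simp
    qed
    show ?thesis using s[of p "1 - p"] s[of "1 - p" p] p by (simp add: T_def mult.commute)
  qed
  have T2: "p * (T True)\<^sup>2 + (1 - p) * (T False)\<^sup>2 = 1"
    using p by (simp add: T_def)
  have E: "(\<integral>j. f j \<partial>measure_pmf Q)
      = (\<Sum>i\<in>UNIV. p * (f (True, i, True) + f (True, i, False)) + (1 - p) * (f (False, i, True) + f (False, i, False)))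
        / (2 * N)" for f :: "bool \<times> ('n \<times> bool) \<Rightarrow> real"
    unfolding Q_def N_def using p by (intro expectation_bernoulli_axes) auto
  have vz: "v \<bullet> z (y, i, s) = (v \<bullet> \<zeta> + T y * ((R *v v) \<bullet> w))
      + (if s then 1 else -1) * (sqrt N * ((R *v v) - ((R *v v) \<bullet> w) *\<^sub>R w) $ i)" for v y i s
  proof -
    have "v \<bullet> z (y, i, s) = v \<bullet> \<zeta> + (R *v v) \<bullet> (T y *\<^sub>R w + (g i s - (w \<bullet> g i s) *\<^sub>R w))"
      by (simp add: z_def inner_add_right inner_mult_symmetric[OF R, symmetric])
    also have "\<dots> = v \<bullet> \<zeta> + T y * ((R *v v) \<bullet> w) + ((R *v v) - ((R *v v) \<bullet> w) *\<^sub>R w) \<bullet> g i s"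
      by (simp add: inner_add_right inner_diff_right inner_diff_left)
    finally show ?thesis by (simp add: g_def inner_axis)
  qed
  show thesis
  proof (rule that[of Q z "{True} \<times> UNIV"])
    fix v
    show "(\<integral>j. v \<bullet> z j \<partial>measure_pmf Q) = v \<bullet> \<zeta>"
    proof -
      have "(\<integral>j. v \<bullet> z j \<partial>measure_pmf Q)
        = (\<Sum>i\<in>(UNIV::'n set). 2 * (v \<bullet> \<zeta> + (p * T True + (1 - p) * T False) * ((R *v v) \<bullet> w))) / (2 * N)"
        using p by (subst E) (auto simp: vz algebra_simps intro!: sum.cong)
      then show ?thesis using N unfolding T1 by (simp flip: N_def)
    qed
    define k where "k = (R *v v) \<bullet> w"
    define x where "x = (R *v v) - k *\<^sub>R w"
    show "(\<integral>j. (v \<bullet> z j)\<^sup>2 \<partial>measure_pmf Q) = (v \<bullet> \<zeta>)\<^sup>2 + (norm (R *v v))\<^sup>2"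
    proof -
      have sq: "p * ((A + B)\<^sup>2 + (A - B)\<^sup>2) + (1 - p) * ((C + B)\<^sup>2 + (C - B)\<^sup>2)
          = 2 * (p * A\<^sup>2 + (1 - p) * C\<^sup>2) + 2 * B\<^sup>2" for A B C :: real
        by (simp add: power2_eq_square algebra_simps)
      have AC: "p * (v \<bullet> \<zeta> + T True * k)\<^sup>2 + (1 - p) * (v \<bullet> \<zeta> + T False * k)\<^sup>2 = (v \<bullet> \<zeta>)\<^sup>2 + k\<^sup>2"
      proof -
        have "p * (v \<bullet> \<zeta> + T True * k)\<^sup>2 + (1 - p) * (v \<bullet> \<zeta> + T False * k)\<^sup>2
          = (v \<bullet> \<zeta>)\<^sup>2 + 2 * (v \<bullet> \<zeta>) * k * (p * T True + (1 - p) * T False)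
            + (p * (T True)\<^sup>2 + (1 - p) * (T False)\<^sup>2) * k\<^sup>2"
          by (simp add: power2_eq_square algebra_simps)
        then show ?thesis unfolding T1 T2 by simp
      qed
      have vz': "v \<bullet> z (y, i, s) = (v \<bullet> \<zeta> + T y * k) + (if s then 1 else -1) * (sqrt N * x $ i)" for y i s
        unfolding vz k_def x_def ..
      have sN: "(sqrt N * x $ i)\<^sup>2 = N * (x $ i)\<^sup>2" for i
        using N by (simp add: power_mult_distrib)
      have "(\<integral>j. (v \<bullet> z j)\<^sup>2 \<partial>measure_pmf Q)
        = (\<Sum>i\<in>UNIV. p * ((v \<bullet> \<zeta> + T True * k + sqrt N * x $ i)\<^sup>2 + (v \<bullet> \<zeta> + T True * k - sqrt N * x $ i)\<^sup>2)
           + (1 - p) * ((v \<bullet> \<zeta> + T False * k + sqrt N * x $ i)\<^sup>2 + (v \<bullet> \<zeta> + T False * k - sqrt N * x $ i)\<^sup>2)) / (2 * N)"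
        unfolding E vz' by simp
      also have "\<dots> = (\<Sum>i\<in>(UNIV::'n set). 2 * ((v \<bullet> \<zeta>)\<^sup>2 + k\<^sup>2) + 2 * N * (x $ i)\<^sup>2) / (2 * N)"
        unfolding sq AC sN by (simp add: mult.assoc)
      also have "(\<Sum>i\<in>(UNIV::'n set). 2 * ((v \<bullet> \<zeta>)\<^sup>2 + k\<^sup>2) + 2 * N * (x $ i)\<^sup>2)
        = 2 * N * ((v \<bullet> \<zeta>)\<^sup>2 + k\<^sup>2 + (\<Sum>i\<in>UNIV. (x $ i)\<^sup>2))"
        by (simp add: sum.distrib sum_distrib_left distrib_left flip: N_def)
      also have "\<dots> / (2 * N) = (v \<bullet> \<zeta>)\<^sup>2 + k\<^sup>2 + (\<Sum>i\<in>UNIV. (x $ i)\<^sup>2)"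
        using N by simp
      also have "(\<Sum>i\<in>UNIV. (x $ i)\<^sup>2) = x \<bullet> x" by (simp add: inner_vec_def power2_eq_square)
      also have "x \<bullet> x = (norm (R *v v))\<^sup>2 - k\<^sup>2"
      proof -
        have wk: "w \<bullet> (R *v v) = k" by (simp add: k_def inner_commute)
        show ?thesis
          unfolding x_def power2_norm_eq_inner
          by (simp add: inner_diff_left inner_diff_right wk ww power2_eq_square flip: k_def)
      qed
      finally show ?thesis by simp
    qed
  next
    fix j :: "bool \<times> ('n \<times> bool)" assume "j \<in> {True} \<times> UNIV"
    then obtain i s where j: "j = (True, i, s)" by auto
    show "a \<bullet> z j = a \<bullet> \<zeta> + norm (R *v a) * sqrt ((1 - p) / p)"
      unfolding j vz Raw using \<sigma> by (simp add: ww T_def) (simp add: w_def \<sigma>_def)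
  next
    have "measure (measure_pmf Q) ({True} \<times> UNIV) = (\<integral>j. indicator ({True} \<times> UNIV) j \<partial>measure_pmf Q)"
      by simp
    also have "\<dots> = p"
      using p N by (subst E) (auto simp flip: N_def)
    finally show "measure (measure_pmf Q) ({True} \<times> UNIV) = p" .
  qed
qed

section \<open>The chance constraint\<close>

lemma outer_mult: "outer u w *v v = (w \<bullet> v) *\<^sub>R u"
  by (simp add: outer_def vec_eq_iff matrix_vector_mult_def inner_vec_def sum_distrib_left mult_ac)

lemma symmetric_eq_if_quadratic_form_eq:
  fixes A B :: "real^'n^'n"
  assumes A: "transpose A = A" and B: "transpose B = B" and eq: "\<And>v. v \<bullet> (A *v v) = v \<bullet> (B *v v)"
  shows "A = B"
proof -
  have "u \<bullet> (A *v v) = u \<bullet> (B *v v)" for u v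
    using eq[of "u + v"] eq[of u] eq[of v] inner_mult_symmetric[OF A, of v u] inner_mult_symmetric[OF B, of v u]
    by (simp add: matrix_vector_right_distrib inner_add_left inner_add_right inner_commute)
  then have "A *v v = B *v v" for v using vector_eq_ldot by blast
  then show ?thesis by (simp add: matrix_eq)
qed

lemma quadratic_form_integral:
  fixes P :: "(real^'n) measure"
  assumes "integrable P (\<lambda>\<xi>. outer \<xi> \<xi>)"
  shows "integrable P (\<lambda>\<xi>. (v \<bullet> \<xi>)\<^sup>2)" "(\<integral>\<xi>. (v \<bullet> \<xi>)\<^sup>2 \<partial>P) = v \<bullet> ((\<integral>\<xi>. outer \<xi> \<xi> \<partial>P) *v v)"
proof -
  have "linear (\<lambda>A :: real^'n^'n. v \<bullet> (A *v v))"
    by (intro linearI) (simp_all add: matrix_vector_mult_add_rdistrib inner_add_right scaleR_matrix_vector_assoc[symmetric])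
  then have bl: "bounded_linear (\<lambda>A :: real^'n^'n. v \<bullet> (A *v v))"
    by (simp add: linear_conv_bounded_linear)
  have "v \<bullet> (outer \<xi> \<xi> *v v) = (v \<bullet> \<xi>)\<^sup>2" for \<xi>
    by (simp add: outer_mult power2_eq_square inner_commute)
  then show "integrable P (\<lambda>\<xi>. (v \<bullet> \<xi>)\<^sup>2)" "(\<integral>\<xi>. (v \<bullet> \<xi>)\<^sup>2 \<partial>P) = v \<bullet> ((\<integral>\<xi>. outer \<xi> \<xi> \<partial>P) *v v)"
    using integrable_bounded_linear[OF bl assms] integral_bounded_linear[OF bl assms] by simp_all
qed

lemma transpose_second_moment:
  fixes P :: "(real^'n) measure"
  assumes "integrable P (\<lambda>\<xi>. outer \<xi> \<xi>)"
  shows "transpose (\<integral>\<xi>. outer \<xi> \<xi> \<partial>P) = (\<integral>\<xi>. outer \<xi> \<xi> \<partial>P)"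
proof -
  have bl: "bounded_linear (\<lambda>A :: real^'n^'n. A $ i $ j)" for i j
    by (simp add: linear_conv_bounded_linear[symmetric] linearI)
  have "(\<integral>\<xi>. outer \<xi> \<xi> \<partial>P) $ i $ j = (\<integral>\<xi>. \<xi> $ i * \<xi> $ j \<partial>P)" for i j
    using integral_bounded_linear[OF bl assms, of i j] by (simp add: outer_def)
  then show ?thesis by (simp add: transpose_def vec_eq_iff mult.commute)
qed

text \<open>
Preimages under the linear map \<open>z \<mapsto> a \<bullet> z\<close> commute with scaling, so unimodality passes to
one-dimensional projections.
\<close>

lemma projection_unimodal:
  fixes P :: "(real^'n) measure" and a m :: "real^'n"
  assumes P: "prob_space P" "sets P = sets borel" and uni: "alpha_unimodal \<alpha> m P"
    and t: "t > 1" and B: "B \<in> sets borel"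
  defines "M \<equiv> distr P borel (\<lambda>\<xi>. a \<bullet> (\<xi> - m))"
  shows "measure M B \<le> t powr \<alpha> * measure M {x. t * x \<in> B}"
proof -
  note [measurable_cong] = P(2)
  have [measurable]: "B \<in> sets borel" by fact
  define P' where "P' = distr P borel (\<lambda>\<xi>. \<xi> - m)"
  define B' where "B' = {z. a \<bullet> z \<in> B}"
  have B': "B' \<in> sets borel" unfolding B'_def by measurable
  have [measurable]: "{x. t * x \<in> B} \<in> sets borel" by measurable
  have M: "M = distr P' borel (\<lambda>z. a \<bullet> z)"
    unfolding M_def P'_def by (subst distr_distr) (auto simp: comp_def)
  have sp: "space P' = UNIV" by (simp add: P'_def)
  have "mono_on {0<..} (\<lambda>t. t powr \<alpha> * measure P' ((\<lambda>z. z /\<^sub>R t) ` B'))"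
    using uni B' unfolding alpha_unimodal_def alpha_unimodal0_def P'_def by blast
  from mono_onD[OF this, of 1 t] t
  have "measure P' B' \<le> t powr \<alpha> * measure P' ((\<lambda>z. z /\<^sub>R t) ` B')" by simp
  moreover have "(\<lambda>z. z /\<^sub>R t) ` B' = {z. t * (a \<bullet> z) \<in> B}"
    using t by (auto simp: B'_def image_iff mult.assoc[symmetric] intro!: exI[where x="t *\<^sub>R _"])
  moreover have "measure M S = measure P' {z. a \<bullet> z \<in> S}" if "S \<in> sets borel" for S
    unfolding M using that by (subst measure_distr) (auto simp: P'_def vimage_def)
  ultimately show ?thesis by (simp add: B'_def)
qed

lemma Lambda_props:
  fixes \<mu> m :: "real^'n"
  assumes "((\<alpha> + 2) / \<alpha>) *\<^sub>R (\<Sigma> - outer \<mu> \<mu>) \<succ> (1 / \<alpha>\<^sup>2) *\<^sub>R outer (\<mu> - m) (\<mu> - m)"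
  defines "R \<equiv> Lambda \<alpha> \<mu> \<Sigma> m"
  shows "pos_def R"
    and "(norm (R *v v))\<^sup>2 = (\<alpha> + 2) / \<alpha> * (v \<bullet> (\<Sigma> *v v) - (v \<bullet> \<mu>)\<^sup>2) - (v \<bullet> (\<mu> - m))\<^sup>2 / \<alpha>\<^sup>2"
proof -
  let ?C = "((\<alpha> + 2) / \<alpha>) *\<^sub>R (\<Sigma> - outer \<mu> \<mu>) - (1 / \<alpha>\<^sup>2) *\<^sub>R outer (\<mu> - m) (\<mu> - m)"
  have C: "pos_def ?C" using assms(1) by (simp add: mat_succ_def)
  note R = mat_sqrt_props[OF C, folded Lambda_def, folded R_def]
  show "pos_def R" by (rule R(1))
  have s: "transpose R = R" using R(1) by (simp add: pos_def_def)
  have "(norm (R *v v))\<^sup>2 = v \<bullet> (?C *v v)"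
    unfolding power2_norm_eq_inner inner_mult_symmetric[OF s] R(2)[symmetric]
    by (simp add: matrix_vector_mul_assoc)
  also have "\<dots> = (\<alpha> + 2) / \<alpha> * (v \<bullet> (\<Sigma> *v v) - (v \<bullet> \<mu>)\<^sup>2) - (v \<bullet> (\<mu> - m))\<^sup>2 / \<alpha>\<^sup>2"
    by (simp only: matrix_vector_mult_diff_rdistrib inner_diff_right scaleR_matrix_vector_assoc[symmetric]
        outer_mult inner_scaleR_right)
       (simp add: inner_commute inner_diff_right power2_eq_square)
  finally show "(norm (R *v v))\<^sup>2 = (\<alpha> + 2) / \<alpha> * (v \<bullet> (\<Sigma> *v v) - (v \<bullet> \<mu>)\<^sup>2) - (v \<bullet> (\<mu> - m))\<^sup>2 / \<alpha>\<^sup>2" .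
qed

text \<open>
With \<open>u = v \<bullet> \<mu>\<close>, \<open>w = v \<bullet> m\<close> and \<open>X = v \<bullet> \<Sigma> v\<close>: the factor \<open>\<alpha>/(\<alpha>+2)\<close> times the second moment
of \<open>v \<bullet> Z\<close>, namely its squared mean plus the variance given by \<open>\<Lambda>\<^sub>m\<close>, is the second moment of
\<open>v \<bullet> (\<xi> - m)\<close>. The term \<open>(1/\<alpha>\<^sup>2) (\<mu> - m) (\<mu> - m)\<^sup>T\<close> in \<open>\<Lambda>\<^sub>m\<^sup>2\<close> is what
makes this hold, since \<open>(\<alpha>+1)\<^sup>2 - 1 = \<alpha> (\<alpha>+2)\<close>.
\<close>

lemma second_moment_identity:
  fixes \<alpha> u w X :: real
  assumes \<alpha>: "\<alpha> > 0"
  shows "\<alpha> / (\<alpha> + 2) * (((\<alpha> + 1) / \<alpha> * (u - w))\<^sup>2 + ((\<alpha> + 2) / \<alpha> * (X - u\<^sup>2) - (u - w)\<^sup>2 / \<alpha>\<^sup>2))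
    = X - u\<^sup>2 + (u - w)\<^sup>2"
proof -
  have "((\<alpha> + 1) / \<alpha> * (u - w))\<^sup>2 - (u - w)\<^sup>2 / \<alpha>\<^sup>2 = (\<alpha> + 2) / \<alpha> * (u - w)\<^sup>2"
    using \<alpha> by (simp add: power2_eq_square divide_simps) (simp add: algebra_simps)
  then have "((\<alpha> + 1) / \<alpha> * (u - w))\<^sup>2 + ((\<alpha> + 2) / \<alpha> * (X - u\<^sup>2) - (u - w)\<^sup>2 / \<alpha>\<^sup>2)
    = (\<alpha> + 2) / \<alpha> * (X - u\<^sup>2 + (u - w)\<^sup>2)" by (simp add: distrib_left)
  then show ?thesis using \<alpha> by simp
qed

text \<open>
This is \<open>unimodal_tail_bound\<close> for the law of \<open>a \<bullet> (\<xi> - m)\<close>, with \<open>y = \<tau> d\<close> translating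
between the two forms of the condition. The case \<open>d = 0\<close> is the limit \<open>\<tau> \<rightarrow> \<infinity>\<close>, and \<open>a = 0\<close>, where
the variance degenerates, is trivial.
\<close>

lemma chance_constraint_sufficient:
  fixes P :: "(real^'n) measure" and a \<mu> m :: "real^'n"
  assumes \<alpha>: "\<alpha> > 0" and \<epsilon>: "0 < \<epsilon>" "\<epsilon> < 1"
    and P: "prob_space P" "sets P = sets borel"
    and i1: "integrable P (\<lambda>\<xi>. \<xi>)" and m1: "(\<integral>\<xi>. \<xi> \<partial>P) = \<mu>"
    and i2: "integrable P (\<lambda>\<xi>. outer \<xi> \<xi>)" and m2: "(\<integral>\<xi>. outer \<xi> \<xi> \<partial>P) = \<Sigma>"
    and uni: "alpha_unimodal \<alpha> m P"
    and succ: "((\<alpha> + 2) / \<alpha>) *\<^sub>R (\<Sigma> - outer \<mu> \<mu>) \<succ> (1 / \<alpha>\<^sup>2) *\<^sub>R outer (\<mu> - m) (\<mu> - m)"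
    and b: "a \<bullet> m \<le> b"
    and cond: "\<And>\<tau>. \<tau> \<ge> (1 / (1 - \<epsilon>)) powr (1 / \<alpha>) \<Longrightarrow>
        sqrt ((1 - \<epsilon> - \<tau> powr (-\<alpha>)) / \<epsilon>) * norm (Lambda \<alpha> \<mu> \<Sigma> m *v a)
          \<le> \<tau> * (b - \<mu> \<bullet> a) + (\<tau> - (\<alpha> + 1) / \<alpha>) * ((\<mu> - m) \<bullet> a)"
  shows "1 - \<epsilon> \<le> measure P {\<xi>. a \<bullet> \<xi> \<le> b}"
proof (cases "a = 0")
  case True
  interpret prob_space P by fact
  have "{\<xi>. a \<bullet> \<xi> \<le> b} = space P" using True b P(2) by (auto dest: sets_eq_imp_space_eq)
  then show ?thesis using \<epsilon> by (simp add: prob_space)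
next
  case False
  interpret prob_space P by fact
  note [measurable_cong] = P(2)
  have sp: "space P = UNIV" using P(2) by (metis sets_eq_imp_space_eq space_borel)
  define R where "R = Lambda \<alpha> \<mu> \<Sigma> m"
  define \<sigma> where "\<sigma> = norm (R *v a)"
  define \<rho> where "\<rho> = (\<alpha> + 1) / \<alpha> * (a \<bullet> (\<mu> - m))"
  define d where "d = b - a \<bullet> m"
  note R = Lambda_props[OF succ, folded R_def]
  have \<sigma>: "\<sigma> > 0" using R(1) False unfolding \<sigma>_def pos_def_def by (metis inner_zero_right less_irrefl zero_less_norm_iff)
  have d: "d \<ge> 0" using b by (simp add: d_def)
  have cond': "\<sigma> * sqrt ((1 - \<epsilon> - \<tau> powr (-\<alpha>)) / \<epsilon>) + \<rho> \<le> \<tau> * d" if "\<tau> \<ge> (1 / (1 - \<epsilon>)) powr (1 / \<alpha>)" for \<tau>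
    using cond[OF that] by (simp add: \<sigma>_def R_def \<rho>_def d_def inner_diff_left inner_diff_right inner_commute algebra_simps)
  have star: "\<rho> + \<sigma> * sqrt ((1 - \<epsilon> - (d / y) powr \<alpha>) / \<epsilon>) \<le> y" if y: "d < y" "(d / y) powr \<alpha> \<le> 1 - \<epsilon>" for y
  proof (cases "d = 0")
    case d0: False
    have e: "(y / d) powr (-\<alpha>) = (d / y) powr \<alpha>" using d d0 y by (simp add: powr_minus_divide powr_divide)
    have "1 / (1 - \<epsilon>) \<le> (y / d) powr \<alpha>"
    proof -
      have "(y / d) powr \<alpha> = 1 / (d / y) powr \<alpha>"
        using d d0 y(1) by (simp add: powr_divide)
      moreover have "(d / y) powr \<alpha> > 0" using d d0 y(1) by simp
      ultimately show ?thesis using y(2) by (simp add: frac_le)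
    qed
    then have "(1 / (1 - \<epsilon>)) powr (1 / \<alpha>) \<le> ((y / d) powr \<alpha>) powr (1 / \<alpha>)"
      using \<epsilon> \<alpha> by (intro powr_mono2) auto
    also have "\<dots> = y / d" using d d0 y \<alpha> by (simp add: powr_powr)
    finally have "\<sigma> * sqrt ((1 - \<epsilon> - (y / d) powr (-\<alpha>)) / \<epsilon>) + \<rho> \<le> (y / d) * d" by (rule cond')
    then show ?thesis unfolding e using d0 by simp
  next
    case True
    have "((\<lambda>\<tau>. \<sigma> * sqrt ((1 - \<epsilon> - \<tau> powr (-\<alpha>)) / \<epsilon>) + \<rho>) \<longlongrightarrow> \<sigma> * sqrt ((1 - \<epsilon> - 0) / \<epsilon>) + \<rho>) at_top"
      using \<alpha> \<epsilon> by (intro tendsto_intros tendsto_neg_powr filterlim_ident) auto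
    moreover have "\<forall>\<^sub>F \<tau> in at_top. \<sigma> * sqrt ((1 - \<epsilon> - \<tau> powr (-\<alpha>)) / \<epsilon>) + \<rho> \<le> 0"
      using eventually_ge_at_top[of "(1 / (1 - \<epsilon>)) powr (1 / \<alpha>)"]
      by eventually_elim (use cond' True in auto)
    ultimately have "\<sigma> * sqrt ((1 - \<epsilon> - 0) / \<epsilon>) + \<rho> \<le> 0"
      by (rule tendsto_upperbound) simp
    then show ?thesis using True y by simp
  qed
  define M where "M = distr P borel (\<lambda>\<xi>. a \<bullet> (\<xi> - m))"
  have M: "prob_space M" "sets M = sets borel"
    unfolding M_def by (auto intro!: prob_space_distr)
  have ia: "integrable P (\<lambda>\<xi>. a \<bullet> \<xi>)" using i1 by auto
  have ea: "(\<integral>\<xi>. a \<bullet> \<xi> \<partial>P) = a \<bullet> \<mu>" using i1 m1 by (subst integral_inner_right) auto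
  note q = quadratic_form_integral[OF i2, of a, unfolded m2]
  have sq: "(a \<bullet> (\<xi> - m))\<^sup>2 = (a \<bullet> \<xi>)\<^sup>2 - 2 * (a \<bullet> m) * (a \<bullet> \<xi>) + (a \<bullet> m)\<^sup>2" for \<xi>
    by (simp add: inner_diff_right power2_eq_square algebra_simps)
  have "integrable M (\<lambda>x. x)" "integrable M (\<lambda>x. x\<^sup>2)"
    unfolding M_def using ia q(1) by (simp_all add: integrable_distr_eq sq) (simp add: inner_diff_right)
  moreover have "(\<integral>x. x \<partial>M) = \<alpha> / (\<alpha> + 1) * \<rho>"
  proof -
    have "(\<integral>x. x \<partial>M) = a \<bullet> \<mu> - a \<bullet> m"
      unfolding M_def using ia ea prob_space by (simp add: integral_distr inner_diff_right)
    then show ?thesis using \<alpha> by (simp add: \<rho>_def inner_diff_right)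
  qed
  moreover have "(\<integral>x. x\<^sup>2 \<partial>M) = \<alpha> / (\<alpha> + 2) * (\<rho>\<^sup>2 + \<sigma>\<^sup>2)"
  proof -
    define X where "X = a \<bullet> (\<Sigma> *v a)"
    define u where "u = a \<bullet> \<mu>"
    define w where "w = a \<bullet> m"
    have "(\<integral>x. x\<^sup>2 \<partial>M) = X - 2 * w * u + w\<^sup>2"
      unfolding M_def using ia q ea prob_space by (simp add: integral_distr sq X_def u_def w_def)
    moreover have "\<rho> = (\<alpha> + 1) / \<alpha> * (u - w)" by (simp add: \<rho>_def u_def w_def inner_diff_right)
    moreover have "\<sigma>\<^sup>2 = (\<alpha> + 2) / \<alpha> * (X - u\<^sup>2) - (u - w)\<^sup>2 / \<alpha>\<^sup>2"
      unfolding \<sigma>_def R(2) by (simp add: X_def u_def w_def inner_diff_right)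
    moreover have "X - 2 * w * u + w\<^sup>2
        = \<alpha> / (\<alpha> + 2) * (((\<alpha> + 1) / \<alpha> * (u - w))\<^sup>2 + ((\<alpha> + 2) / \<alpha> * (X - u\<^sup>2) - (u - w)\<^sup>2 / \<alpha>\<^sup>2))"
      unfolding second_moment_identity[OF \<alpha>] by (simp add: power2_eq_square algebra_simps)
    ultimately show ?thesis by simp
  qed
  ultimately have "measure M {d<..} \<le> \<epsilon>"
    using projection_unimodal[OF P uni, of _ _ a, folded M_def] \<sigma> d \<epsilon> \<alpha> star
    by (intro unimodal_tail_bound[OF M]) auto
  moreover have "measure M {d<..} = measure P {\<xi>. b < a \<bullet> \<xi>}"
    unfolding M_def by (subst measure_distr) (auto simp: sp d_def inner_diff_right vimage_def)
  moreover have "measure P {\<xi>. a \<bullet> \<xi> \<le> b} = 1 - measure P {\<xi>. b < a \<bullet> \<xi>}"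
  proof -
    have "{\<xi>. a \<bullet> \<xi> \<le> b} = space P - {\<xi>. b < a \<bullet> \<xi>}" by (auto simp: sp)
    then show ?thesis by (simp add: prob_compl)
  qed
  ultimately show ?thesis by simp
qed

lemma star_law_in_ambiguity_set:
  fixes z :: "'j::finite \<Rightarrow> real^'n" and \<mu> m :: "real^'n"
  assumes \<alpha>: "\<alpha> > 0" and \<Sigma>: "transpose \<Sigma> = \<Sigma>" and m: "m \<in> \<Xi>"
    and succ: "((\<alpha> + 2) / \<alpha>) *\<^sub>R (\<Sigma> - outer \<mu> \<mu>) \<succ> (1 / \<alpha>\<^sup>2) *\<^sub>R outer (\<mu> - m) (\<mu> - m)"
    and z1: "\<And>v. (\<integral>j. v \<bullet> z j \<partial>measure_pmf Q) = v \<bullet> (((\<alpha> + 1) / \<alpha>) *\<^sub>R (\<mu> - m))"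
    and z2: "\<And>v. (\<integral>j. (v \<bullet> z j)\<^sup>2 \<partial>measure_pmf Q)
      = (v \<bullet> (((\<alpha> + 1) / \<alpha>) *\<^sub>R (\<mu> - m)))\<^sup>2 + (norm (Lambda \<alpha> \<mu> \<Sigma> m *v v))\<^sup>2"
  shows "star_law \<alpha> m z Q \<in> ambiguity_set \<Xi> \<alpha> \<mu> \<Sigma>"
proof -
  let ?P = "star_law \<alpha> m z Q"
  note M = star_law_moments[OF \<alpha>, of m z Q]
  have "v \<bullet> (\<integral>\<xi>. \<xi> \<partial>?P) = v \<bullet> \<mu>" for v
  proof -
    have "v \<bullet> (\<integral>\<xi>. \<xi> \<partial>?P) = v \<bullet> m + \<alpha> / (\<alpha> + 1) * (v \<bullet> (((\<alpha> + 1) / \<alpha>) *\<^sub>R (\<mu> - m)))"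
      using M(1) M(3)[of v] z1[of v] by simp
    then show ?thesis using \<alpha> by (simp add: inner_diff_right)
  qed
  then have mean: "(\<integral>\<xi>. \<xi> \<partial>?P) = \<mu>" using vector_eq_ldot by blast
  have second: "(\<integral>\<xi>. outer \<xi> \<xi> \<partial>?P) = \<Sigma>"
  proof (rule symmetric_eq_if_quadratic_form_eq[OF transpose_second_moment[OF M(2)] \<Sigma>])
    fix v
    define X where "X = v \<bullet> (\<Sigma> *v v)"
    define u where "u = v \<bullet> \<mu>"
    define w where "w = v \<bullet> m"
    have "v \<bullet> ((\<integral>\<xi>. outer \<xi> \<xi> \<partial>?P) *v v) = w\<^sup>2
      + 2 * w * (\<alpha> / (\<alpha> + 1)) * ((\<alpha> + 1) / \<alpha> * (u - w))
      + \<alpha> / (\<alpha> + 2) * (((\<alpha> + 1) / \<alpha> * (u - w))\<^sup>2 + ((\<alpha> + 2) / \<alpha> * (X - u\<^sup>2) - (u - w)\<^sup>2 / \<alpha>\<^sup>2))"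
      unfolding quadratic_form_integral(2)[OF M(2), symmetric] M(4) z1 z2 Lambda_props(2)[OF succ]
      by (simp add: X_def u_def w_def inner_diff_right)
    also have "\<alpha> / (\<alpha> + 2) * (((\<alpha> + 1) / \<alpha> * (u - w))\<^sup>2 + ((\<alpha> + 2) / \<alpha> * (X - u\<^sup>2) - (u - w)\<^sup>2 / \<alpha>\<^sup>2))
      = X - u\<^sup>2 + (u - w)\<^sup>2"
      by (rule second_moment_identity[OF \<alpha>])
    also have "2 * w * (\<alpha> / (\<alpha> + 1)) * ((\<alpha> + 1) / \<alpha> * (u - w)) = 2 * w * (u - w)" using \<alpha> by simp
    finally show "v \<bullet> ((\<integral>\<xi>. outer \<xi> \<xi> \<partial>?P) *v v) = v \<bullet> (\<Sigma> *v v)"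
      by (simp add: X_def power2_eq_square algebra_simps)
  qed
  show ?thesis
    unfolding ambiguity_set_def
    using prob_space_star_law[of \<alpha> m z Q] M(1,2) mean second m alpha_unimodal_star_law[OF \<alpha>, of m z Q] by auto
qed

text \<open>
The two-point construction needs \<open>p < 1\<close>, that is \<open>\<tau>\<close> strictly above \<open>(1/(1-\<epsilon>))\<^bsup>1/\<alpha>\<^esup>\<close>. Since the
violated inequality is strict and continuous in \<open>\<tau>\<close>, it persists for some larger \<open>t\<close>.
\<close>

lemma violating_law:
  fixes a \<mu> m :: "real^'n"
  assumes \<alpha>: "\<alpha> > 0" and \<epsilon>: "0 < \<epsilon>" "\<epsilon> < 1" and \<Sigma>: "transpose \<Sigma> = \<Sigma>" and m: "m \<in> \<Xi>"
    and succ: "((\<alpha> + 2) / \<alpha>) *\<^sub>R (\<Sigma> - outer \<mu> \<mu>) \<succ> (1 / \<alpha>\<^sup>2) *\<^sub>R outer (\<mu> - m) (\<mu> - m)"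
    and b: "a \<bullet> m \<le> b" and \<tau>: "\<tau> \<ge> (1 / (1 - \<epsilon>)) powr (1 / \<alpha>)"
    and viol: "\<tau> * (b - \<mu> \<bullet> a) + (\<tau> - (\<alpha> + 1) / \<alpha>) * ((\<mu> - m) \<bullet> a)
      < sqrt ((1 - \<epsilon> - \<tau> powr (-\<alpha>)) / \<epsilon>) * norm (Lambda \<alpha> \<mu> \<Sigma> m *v a)"
  obtains P where "P \<in> ambiguity_set \<Xi> \<alpha> \<mu> \<Sigma>" "measure P {\<xi>. a \<bullet> \<xi> \<le> b} < 1 - \<epsilon>"
proof -
  define R where "R = Lambda \<alpha> \<mu> \<Sigma> m"
  define \<sigma> where "\<sigma> = norm (R *v a)"
  define \<zeta> where "\<zeta> = ((\<alpha> + 1) / \<alpha>) *\<^sub>R (\<mu> - m)"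
  define \<rho> where "\<rho> = a \<bullet> \<zeta>"
  define d where "d = b - a \<bullet> m"
  note R = Lambda_props(1)[OF succ, folded R_def]
  have d: "d \<ge> 0" using b by (simp add: d_def)
  define G where "G t = \<sigma> * sqrt ((1 - \<epsilon> - t powr (-\<alpha>)) / \<epsilon>) + \<rho> - t * d" for t
  have G: "G \<tau> > 0"
    using viol by (simp add: G_def \<sigma>_def R_def \<rho>_def \<zeta>_def d_def inner_diff_left inner_diff_right inner_commute algebra_simps)
  have "1 / (1 - \<epsilon>) > 1" using \<epsilon> by simp
  then have \<tau>0: "(1 / (1 - \<epsilon>)) powr (1 / \<alpha>) > 1" using \<alpha> by (simp add: gr_one_powr)
  then have \<tau>1: "\<tau> > 1" using \<tau> by simp
  have a: "a \<noteq> 0"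
  proof
    assume "a = 0"
    then have "\<tau> * b < 0" using viol by simp
    moreover have "0 \<le> \<tau> * b" using b \<open>a = 0\<close> \<tau>1 by simp
    ultimately show False by simp
  qed
  have Ra: "R *v a \<noteq> 0" using R a unfolding pos_def_def by (metis inner_zero_right less_irrefl)
  have "(G \<longlongrightarrow> G \<tau>) (at_right \<tau>)"
    unfolding G_def using \<tau>1 \<epsilon> by (intro tendsto_intros) auto
  then have "\<forall>\<^sub>F t in at_right \<tau>. 0 < G t" using G by (rule order_tendstoD)
  moreover have "\<forall>\<^sub>F t in at_right \<tau>. t > \<tau>" by (simp add: eventually_at_filter)
  ultimately have "\<forall>\<^sub>F t in at_right \<tau>. 0 < G t \<and> t > \<tau>" by eventually_elim auto
  then obtain t where t: "0 < G t" "t > \<tau>"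
    using eventually_happens'[of "at_right \<tau>"] by (metis (no_types, lifting) trivial_limit_at_right_real)
  have t1: "t > 1" using t \<tau>1 by simp
  define s where "s = t powr (-\<alpha>)"
  have s: "0 < s" "s < 1 - \<epsilon>"
  proof -
    have "((1 / (1 - \<epsilon>)) powr (1 / \<alpha>)) powr \<alpha> < t powr \<alpha>"
      using \<tau>0 \<tau> t \<alpha> by (intro powr_less_mono2) auto
    then have "1 / (1 - \<epsilon>) < t powr \<alpha>" using \<alpha> \<epsilon> by (simp add: powr_powr)
    then show "s < 1 - \<epsilon>" using \<epsilon> t1 by (simp add: s_def powr_minus field_simps)
    show "0 < s" using t1 by (simp add: s_def)
  qed
  define p where "p = \<epsilon> / (1 - s)"
  have p: "0 < p" "p < 1" using s \<epsilon> by (auto simp: p_def)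
  have odds: "(1 - p) / p = (1 - \<epsilon> - s) / \<epsilon>" using s \<epsilon> by (simp add: p_def field_simps)
  have RT: "transpose R = R" using R by (simp add: pos_def_def)
  obtain z :: "bool \<times> ('n \<times> bool) \<Rightarrow> real^'n" and Q J where
    z1: "\<And>v. (\<integral>j. v \<bullet> z j \<partial>measure_pmf Q) = v \<bullet> \<zeta>" and
    z2: "\<And>v. (\<integral>j. (v \<bullet> z j)\<^sup>2 \<partial>measure_pmf Q) = (v \<bullet> \<zeta>)\<^sup>2 + (norm (R *v v))\<^sup>2" and
    zJ: "\<And>j. j \<in> J \<Longrightarrow> a \<bullet> z j = a \<bullet> \<zeta> + norm (R *v a) * sqrt ((1 - p) / p)" and
    J: "measure (measure_pmf Q) J = p"
    by (rule worst_case_mixture[OF RT Ra p, of \<zeta>]) (rule that)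
  define c where "c = \<rho> + \<sigma> * sqrt ((1 - p) / p)"
  have ct: "t * d < c" using t(1) by (simp add: G_def c_def odds s_def)
  moreover have "1 * d \<le> t * d" using t1 d by (intro mult_right_mono) auto
  ultimately have dc: "d < c" by simp
  let ?P = "star_law \<alpha> m z Q"
  interpret P: prob_space ?P by (rule prob_space_star_law)
  have "\<epsilon> < p * (1 - (d / c) powr \<alpha>)"
  proof -
    have "d / c < 1 / t" using ct t1 d dc by (simp add: field_simps)
    then have "(d / c) powr \<alpha> < (1 / t) powr \<alpha>" using d dc \<alpha> by (intro powr_less_mono2) auto
    also have "\<dots> = s" using t1 by (simp add: s_def powr_minus_divide powr_divide)
    finally have "p * (1 - s) < p * (1 - (d / c) powr \<alpha>)" using p by simp
    moreover have "p * (1 - s) = \<epsilon>" using s \<epsilon> by (simp add: p_def)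
    ultimately show ?thesis by simp
  qed
  also have "\<dots> \<le> measure ?P {\<xi>. a \<bullet> m + d < a \<bullet> \<xi>}"
    unfolding J[symmetric] by (rule star_law_tail[OF \<alpha> d dc]) (simp add: zJ c_def \<rho>_def \<sigma>_def)
  also have "{\<xi>. a \<bullet> m + d < a \<bullet> \<xi>} = {\<xi>. b < a \<bullet> \<xi>}" by (simp add: d_def)
  finally have tail: "\<epsilon> < measure ?P {\<xi>. b < a \<bullet> \<xi>}" .
  have sp: "space ?P = UNIV" by (simp add: star_law_def)
  have "{\<xi>. a \<bullet> \<xi> \<le> b} = space ?P - {\<xi>. b < a \<bullet> \<xi>}" by (auto simp: sp)
  then have "measure ?P {\<xi>. a \<bullet> \<xi> \<le> b} = 1 - measure ?P {\<xi>. b < a \<bullet> \<xi>}"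
    by (simp add: P.prob_compl)
  with tail have "measure ?P {\<xi>. a \<bullet> \<xi> \<le> b} < 1 - \<epsilon>" by simp
  moreover have "?P \<in> ambiguity_set \<Xi> \<alpha> \<mu> \<Sigma>"
    using z1 z2 unfolding R_def \<zeta>_def by (intro star_law_in_ambiguity_set[OF \<alpha> \<Sigma> m succ]) auto
  ultimately show thesis by (rule that[rotated])
qed

theorem mainTheorem1:
  fixes \<Xi> :: "(real^'n) set" and \<alpha> \<epsilon> :: real
    and \<mu> :: "real^'n" and \<Sigma> :: "real^'n^'n"
    and a :: "real^'l \<Rightarrow> real^'n" and b :: "real^'l \<Rightarrow> real" and x :: "real^'l"
  assumes "\<Xi> \<noteq> {}" and "connected \<Xi>" and "compact \<Xi>"
    and "\<alpha> \<ge> 1" and "0 < \<epsilon>" and "\<epsilon> < 1/2"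
    and "transpose \<Sigma> = \<Sigma>"
    and "\<And>m. m \<in> \<Xi> \<Longrightarrow>
      ((\<alpha> + 2) / \<alpha>) *\<^sub>R (\<Sigma> - outer \<mu> \<mu>) \<succ> (1 / \<alpha>\<^sup>2) *\<^sub>R outer (\<mu> - m) (\<mu> - m)"
    and "affine_map a" and "affine_map b"
    and "\<And>m. m \<in> \<Xi> \<Longrightarrow> a x \<bullet> m \<le> b x"
  shows "(INF P\<in>ambiguity_set \<Xi> \<alpha> \<mu> \<Sigma>. ereal (measure P {\<xi>. a x \<bullet> \<xi> \<le> b x})) \<ge> ereal (1 - \<epsilon>)
    \<longleftrightarrow> (\<forall>\<tau> \<ge> (1 / (1 - \<epsilon>)) powr (1 / \<alpha>). \<forall>m\<in>\<Xi>.
          sqrt ((1 - \<epsilon> - \<tau> powr (-\<alpha>)) / \<epsilon>) * norm (Lambda \<alpha> \<mu> \<Sigma> m *v a x)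
          \<le> \<tau> * (b x - \<mu> \<bullet> a x) + (\<tau> - (\<alpha> + 1) / \<alpha>) * ((\<mu> - m) \<bullet> a x))"
proof -
  have \<alpha>: "\<alpha> > 0" and \<epsilon>: "0 < \<epsilon>" "\<epsilon> < 1" using assms by auto
  show ?thesis
    unfolding le_INF_iff ereal_less_eq
  proof (intro iffI allI impI ballI)
    fix \<tau> m
    assume L: "\<forall>P\<in>ambiguity_set \<Xi> \<alpha> \<mu> \<Sigma>. 1 - \<epsilon> \<le> measure P {\<xi>. a x \<bullet> \<xi> \<le> b x}"
      and \<tau>: "(1 / (1 - \<epsilon>)) powr (1 / \<alpha>) \<le> \<tau>" and m: "m \<in> \<Xi>"
    show "sqrt ((1 - \<epsilon> - \<tau> powr (-\<alpha>)) / \<epsilon>) * norm (Lambda \<alpha> \<mu> \<Sigma> m *v a x)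
          \<le> \<tau> * (b x - \<mu> \<bullet> a x) + (\<tau> - (\<alpha> + 1) / \<alpha>) * ((\<mu> - m) \<bullet> a x)"
    proof (rule ccontr)
      assume "\<not> ?thesis"
      then obtain P where "P \<in> ambiguity_set \<Xi> \<alpha> \<mu> \<Sigma>" "measure P {\<xi>. a x \<bullet> \<xi> \<le> b x} < 1 - \<epsilon>"
        using violating_law[OF \<alpha> \<epsilon> assms(7) m assms(8)[OF m] assms(11)[OF m] \<tau>] by (metis not_le)
      with L show False by fastforce
    qed
  next
    fix P
    assume cond: "\<forall>\<tau>\<ge>(1 / (1 - \<epsilon>)) powr (1 / \<alpha>). \<forall>m\<in>\<Xi>.
          sqrt ((1 - \<epsilon> - \<tau> powr (-\<alpha>)) / \<epsilon>) * norm (Lambda \<alpha> \<mu> \<Sigma> m *v a x)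
          \<le> \<tau> * (b x - \<mu> \<bullet> a x) + (\<tau> - (\<alpha> + 1) / \<alpha>) * ((\<mu> - m) \<bullet> a x)"
      and P: "P \<in> ambiguity_set \<Xi> \<alpha> \<mu> \<Sigma>"
    then obtain m where m: "m \<in> \<Xi>" "alpha_unimodal \<alpha> m P" by (auto simp: ambiguity_set_def)
    show "1 - \<epsilon> \<le> measure P {\<xi>. a x \<bullet> \<xi> \<le> b x}"
      using P cond m assms(11)[OF m(1)]
      by (intro chance_constraint_sufficient[OF \<alpha> \<epsilon> _ _ _ _ _ _ m(2) assms(8)[OF m(1)]])
         (auto simp: ambiguity_set_def)
  qed
qed

end
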